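(* Let $W=W(E_6)$ be the Coxeter group of type $E_6$ with longest element $w_o$, and let $W_o\subset W$ be the subgroup of elements commuting with $w_o$. All elements $w_I$ below lie in $W_o$, and conjugacy means conjugacy in $W_o$. The involutions in $W_o$ form exactly eight conjugacy classes, namely the pairwise distinct classes $[w_\emptyset]$, $[w_{\{1,2,3,4,5,6\}}]$, $[w_{\{2\}}]=[w_{\{4\}}]$, $[w_{\{1,3,4,5,6\}}]$, $[w_{\{1,6\}}]=[w_{\{3,5\}}]$, $[w_{\{2,3,4,5\}}]$, $[w_{\{1,4,6\}}]=[w_{\{1,2,6\}}]$, $[w_{\{3,4,5\}}]$. Multiplication by $w_o$ acts on these classes as follows: (1) it interchanges $[w_\emptyset]$ and $[w_{\{1,2,3,4,5,6\}}]$; (2) it interchanges $[w_{\{2\}}]$ and $[w_{\{1,3,4,5,6\}}]$; (3) it interchanges $[w_{\{1,6\}}]$ and $[w_{\{2,3,4,5\}}]$; (4) it fixes $[w_{\{1,4,6\}}]$; (5) it fixes $[w_{\{3,4,5\}}]$.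
   Context: The nodes of the Coxeter graph $E_6$ are numbered as in Bourbaki: nodes $1,3,4,5,6$ form a path in this order and node $2$ is joined to node $4$; all edges have label $3$. Node $i$ corresponds to the simple generator $s_i$. For a set of nodes $I$, $W_I$ denotes the parabolic subgroup generated by $\{s_i: i\in I\}$, and $w_I$ denotes its longest element ($w_\emptyset=1$). An involution is an element $x$ with $x^2=1$ (the identity is included); $[x]$ denotes the conjugacy class of $x$. *)

theory Defs
  imports "HOL-Algebra.Group_Action" "HOL-Algebra.Generated_Groups"
begin

section \<open>Coxeter groups by generators and relations\<close>

text \<open>
  Equality of words in the presentation with generators \<open>S\<close> and relations
  \<open>(i j)^(m i j) = 1\<close>.  Since \<open>m i i = 1\<close> for a Coxeter matrix, each generator is
  its own inverse, so words without formal inverses suffice.  The value \<open>m i j = 0\<close>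
  encodes an infinite label: the corresponding relation is vacuous.
\<close>

inductive coxeter_equiv :: "'a set \<Rightarrow> ('a \<Rightarrow> 'a \<Rightarrow> nat) \<Rightarrow> 'a list \<Rightarrow> 'a list \<Rightarrow> bool"
  for S m where
  relation: "\<lbrakk>i \<in> S; j \<in> S; xs \<in> lists S; ys \<in> lists S\<rbrakk> \<Longrightarrow>
    coxeter_equiv S m (xs @ concat (replicate (m i j) [i, j]) @ ys) (xs @ ys)"
| refl: "xs \<in> lists S \<Longrightarrow> coxeter_equiv S m xs xs"
| sym: "coxeter_equiv S m xs ys \<Longrightarrow> coxeter_equiv S m ys xs"
| trans: "\<lbrakk>coxeter_equiv S m xs ys; coxeter_equiv S m ys zs\<rbrakk> \<Longrightarrow> coxeter_equiv S m xs zs"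

definition coxeter_class :: "'a set \<Rightarrow> ('a \<Rightarrow> 'a \<Rightarrow> nat) \<Rightarrow> 'a list \<Rightarrow> 'a list set" where
  "coxeter_class S m w = {v. coxeter_equiv S m w v}"

definition coxeter_group :: "'a set \<Rightarrow> ('a \<Rightarrow> 'a \<Rightarrow> nat) \<Rightarrow> 'a list set monoid" where
  "coxeter_group S m =
    \<lparr>carrier = coxeter_class S m ` lists S,
     monoid.mult = (\<lambda>A B. \<Union>v\<in>A. \<Union>w\<in>B. coxeter_class S m (v @ w)),
     one = coxeter_class S m []\<rparr>"

text \<open>
  A group element is the set of all words representing it, so its length with respect to
  the simple generators is the least length of its members.
\<close>

definition coxeter_length :: "'a list set \<Rightarrow> nat" where
  "coxeter_length x = (LEAST n. \<exists>w\<in>x. length w = n)"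

definition longest_element :: "'a list set set \<Rightarrow> 'a list set" where
  "longest_element H = (THE w. w \<in> H \<and> (\<forall>v\<in>H. coxeter_length v \<le> coxeter_length w))"

lemma coxeter_equiv_lists:
  "coxeter_equiv S m v w \<Longrightarrow> v \<in> lists S \<and> w \<in> lists S"
proof (induction rule: coxeter_equiv.induct)
  case (relation i j xs ys)
  then have "set (concat (replicate (m i j) [i, j])) \<subseteq> S"
    by (auto simp: set_replicate_conv_if split: if_splits)
  with relation show ?case by (auto simp: in_lists_conv_set)
qed auto

lemma coxeter_equiv_ctxt:
  assumes "coxeter_equiv S m v w" "us \<in> lists S" "zs \<in> lists S"
  shows "coxeter_equiv S m (us @ v @ zs) (us @ w @ zs)"
  using assms(1)
proof (induction rule: coxeter_equiv.induct)
  case (relation i j xs ys)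
  then show ?case
    using coxeter_equiv.relation[of i S j "us @ xs" "ys @ zs" m] assms(2,3) by simp
next
  case (refl xs)
  then show ?case using assms(2,3) by (intro coxeter_equiv.refl) simp
next
  case (sym xs ys)
  show ?case by (rule coxeter_equiv.sym[OF sym.IH])
next
  case (trans xs ys zs)
  show ?case by (rule coxeter_equiv.trans[OF trans.IH])
qed

lemma coxeter_equiv_append:
  assumes "coxeter_equiv S m v v'" "coxeter_equiv S m w w'"
  shows "coxeter_equiv S m (v @ w) (v' @ w')"
proof (rule coxeter_equiv.trans)
  show "coxeter_equiv S m (v @ w) (v' @ w)"
    using coxeter_equiv_ctxt[OF assms(1), of "[]" w] coxeter_equiv_lists[OF assms(2)] by simp
  show "coxeter_equiv S m (v' @ w) (v' @ w')"
    using coxeter_equiv_ctxt[OF assms(2), of v' "[]"] coxeter_equiv_lists[OF assms(1)] by simp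
qed

lemma coxeter_class_eqI:
  "coxeter_equiv S m v w \<Longrightarrow> coxeter_class S m v = coxeter_class S m w"
  unfolding coxeter_class_def
  using coxeter_equiv.trans[of S m v w] coxeter_equiv.trans[of S m w v] coxeter_equiv.sym[of S m v w]
  by blast

lemma coxeter_mult_class:
  assumes "v \<in> lists S" "w \<in> lists S"
  shows "coxeter_class S m v \<otimes>\<^bsub>coxeter_group S m\<^esub> coxeter_class S m w = coxeter_class S m (v @ w)"
proof -
  have "coxeter_class S m (v' @ w') = coxeter_class S m (v @ w)"
    if "v' \<in> coxeter_class S m v" "w' \<in> coxeter_class S m w" for v' w'
  proof -
    from that have "coxeter_equiv S m (v @ w) (v' @ w')"
      unfolding coxeter_class_def by (intro coxeter_equiv_append) simp_all
    then show ?thesis by (rule coxeter_class_eqI[symmetric])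
  qed
  moreover have "v \<in> coxeter_class S m v" "w \<in> coxeter_class S m w"
    unfolding coxeter_class_def using coxeter_equiv.refl[OF assms(1), of m]
      coxeter_equiv.refl[OF assms(2), of m] by simp_all
  ultimately have "(\<Union>v'\<in>coxeter_class S m v. \<Union>w'\<in>coxeter_class S m w. coxeter_class S m (v' @ w'))
      = coxeter_class S m (v @ w)"
    by blast
  then show ?thesis by (simp add: coxeter_group_def)
qed

lemma coxeter_equiv_rev:
  assumes "\<And>i. i \<in> S \<Longrightarrow> m i i = 1" "w \<in> lists S"
  shows "coxeter_equiv S m (rev w @ w) []"
  using assms(2)
proof (induction w)
  case Nil
  then show ?case by (simp add: coxeter_equiv.refl)
next
  case (Cons i w)
  then have "coxeter_equiv S m (rev w @ [i, i] @ w) (rev w @ w)"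
    using coxeter_equiv.relation[of i S i "rev w" w m] assms(1) by (auto simp: in_lists_conv_set)
  then have "coxeter_equiv S m (rev w @ [i, i] @ w) []"
    using Cons.IH by (rule coxeter_equiv.trans)
  then show ?case by simp
qed

theorem group_coxeter_group:
  assumes "\<And>i. i \<in> S \<Longrightarrow> m i i = 1"
  shows "group (coxeter_group S m)"
proof (rule groupI)
  let ?G = "coxeter_group S m"
  have carr: "carrier ?G = coxeter_class S m ` lists S" and one: "\<one>\<^bsub>?G\<^esub> = coxeter_class S m []"
    by (simp_all add: coxeter_group_def)
  show "x \<otimes>\<^bsub>?G\<^esub> y \<in> carrier ?G" if xy: "x \<in> carrier ?G" "y \<in> carrier ?G" for x y
  proof -
    from xy obtain a b where ab: "a \<in> lists S" "b \<in> lists S"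
      "x = coxeter_class S m a" "y = coxeter_class S m b"
      unfolding carr by blast
    then have "a @ b \<in> lists S" by simp
    with ab show ?thesis unfolding carr by (simp only: coxeter_mult_class) (rule imageI)
  qed
  show "\<one>\<^bsub>?G\<^esub> \<in> carrier ?G"
    unfolding carr one by auto
  show "x \<otimes>\<^bsub>?G\<^esub> y \<otimes>\<^bsub>?G\<^esub> z = x \<otimes>\<^bsub>?G\<^esub> (y \<otimes>\<^bsub>?G\<^esub> z)"
    if xyz: "x \<in> carrier ?G" "y \<in> carrier ?G" "z \<in> carrier ?G" for x y z
  proof -
    from xyz obtain a b c where "a \<in> lists S" "b \<in> lists S" "c \<in> lists S"
      "x = coxeter_class S m a" "y = coxeter_class S m b" "z = coxeter_class S m c"
      unfolding carr by blast
    then show ?thesis by (simp add: coxeter_mult_class)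
  qed
  show "\<one>\<^bsub>?G\<^esub> \<otimes>\<^bsub>?G\<^esub> x = x" if "x \<in> carrier ?G" for x
    using that unfolding carr one by (elim imageE) (simp add: coxeter_mult_class)
  show "\<exists>y\<in>carrier ?G. y \<otimes>\<^bsub>?G\<^esub> x = \<one>\<^bsub>?G\<^esub>" if x: "x \<in> carrier ?G" for x
  proof -
    from x obtain w where w: "w \<in> lists S" "x = coxeter_class S m w" unfolding carr by blast
    then have r: "rev w \<in> lists S" by (auto simp: in_lists_conv_set)
    then have "coxeter_class S m (rev w) \<otimes>\<^bsub>?G\<^esub> x = \<one>\<^bsub>?G\<^esub>"
      using coxeter_class_eqI[OF coxeter_equiv_rev[of S m, OF assms w(1)]] w
      by (simp add: coxeter_mult_class one)
    with r show ?thesis unfolding carr by blast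
  qed
qed


section \<open>The group of type \<open>E\<^sub>6\<close>\<close>

definition E6_nodes :: "nat set" where
  "E6_nodes = {1, 2, 3, 4, 5, 6}"

definition E6_edges :: "nat set set" where
  "E6_edges = {{1, 3}, {3, 4}, {4, 5}, {5, 6}, {2, 4}}"

definition E6_matrix :: "nat \<Rightarrow> nat \<Rightarrow> nat" where
  "E6_matrix i j = (if i = j then 1 else if {i, j} \<in> E6_edges then 3 else 2)"

definition E6_group :: "nat list set monoid" where
  "E6_group = coxeter_group E6_nodes E6_matrix"

definition E6_simple :: "nat \<Rightarrow> nat list set" where
  "E6_simple i = coxeter_class E6_nodes E6_matrix [i]"

definition E6_parabolic :: "nat set \<Rightarrow> nat list set set" where
  "E6_parabolic I = generate E6_group (E6_simple ` I)"

definition E6_long :: "nat set \<Rightarrow> nat list set" where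
  "E6_long I = longest_element (E6_parabolic I)"

definition E6_wo :: "nat list set" where
  "E6_wo = longest_element (carrier E6_group)"

definition E6_Wo :: "nat list set monoid" where
  "E6_Wo = E6_group\<lparr>carrier :=
     {x \<in> carrier E6_group. x \<otimes>\<^bsub>E6_group\<^esub> E6_wo = E6_wo \<otimes>\<^bsub>E6_group\<^esub> x}\<rparr>"

definition conj_class :: "('a, 'b) monoid_scheme \<Rightarrow> 'a \<Rightarrow> 'a set" where
  "conj_class G x = orbit G (\<lambda>g. \<lambda>h\<in>carrier G. g \<otimes>\<^bsub>G\<^esub> h \<otimes>\<^bsub>G\<^esub> inv\<^bsub>G\<^esub> g) x"

definition involutions :: "('a, 'b) monoid_scheme \<Rightarrow> 'a set" where
  "involutions G = {x \<in> carrier G. x \<otimes>\<^bsub>G\<^esub> x = \<one>\<^bsub>G\<^esub>}"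

text \<open>The class \<open>[w_I]\<close>, with conjugacy taken in \<open>W_o\<close>.\<close>

definition E6_cl :: "nat set \<Rightarrow> nat list set set" where
  "E6_cl I = conj_class E6_Wo (E6_long I)"

definition E6_wo_times :: "nat list set set \<Rightarrow> nat list set set" where
  "E6_wo_times C = E6_wo <#\<^bsub>E6_Wo\<^esub> C"

end

theory Submission
  imports Defs
begin

text \<open>
  The group acts on the root lattice, and a word \<open>w\<close> gets longer on appending \<open>i\<close> iff it sends the
  simple root \<open>i\<close> to a nonnegative vector. Hence the action is faithful, so identities between words
  can be checked on six integer vectors, and an element of \<open>W\<^sub>I\<close> sending all simple roots of \<open>I\<close> to
  nonpositive vectors is \<open>w\<^sub>I\<close>.

  As \<open>w\<^sub>o\<close> acts by \<open>-flip\<close>, with \<open>flip\<close> the diagram automorphism, the subgroup \<open>W\<^sub>o\<close> consists of the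
  elements commuting with \<open>flip\<close>. If an involution \<open>w\<close> in \<open>W\<^sub>o\<close> sends a simple root \<open>i\<close> to a nonpositive
  vector other than minus the simple root \<open>i\<close> or \<open>flip i\<close>, then conjugation by the product of \<open>i\<close> and
  \<open>flip i\<close> shortens it. Otherwise \<open>w = w\<^sub>J\<close> for a \<open>flip\<close>-stable \<open>J\<close>, and there are only sixteen of
  these. The traces of \<open>w\<close> and \<open>w\<^sub>o w\<close> separate the remaining eight classes.
\<close>

section \<open>The root lattice of a simply laced Coxeter group\<close>

lemma rev_in_lists [simp]: "rev w \<in> lists A \<longleftrightarrow> w \<in> lists A"
  by (simp add: in_lists_conv_set)

locale simply_laced =
  fixes S :: "'a set" and m :: "'a \<Rightarrow> 'a \<Rightarrow> nat"
  assumes fin: "finite S"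
    and diag: "i \<in> S \<Longrightarrow> m i i = 1"
    and m_sym: "m i j = m j i"
    and label: "i \<in> S \<Longrightarrow> j \<in> S \<Longrightarrow> i \<noteq> j \<Longrightarrow> m i j = 2 \<or> m i j = 3"
begin

section \<open>Words modulo the relations, and their length\<close>

abbreviation eqv :: "'a list \<Rightarrow> 'a list \<Rightarrow> bool" (infix "\<approx>" 50)
  where "v \<approx> w \<equiv> coxeter_equiv S m v w"

abbreviation cls :: "'a list \<Rightarrow> 'a list set"
  where "cls \<equiv> coxeter_class S m"

definition len :: "'a list \<Rightarrow> nat"
  where "len w = coxeter_length (cls w)"

lemma eqv_append_left: "v \<approx> w \<Longrightarrow> us \<in> lists S \<Longrightarrow> us @ v \<approx> us @ w"
  using coxeter_equiv_ctxt[of S m v w us "[]"] by simp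

lemma eqv_append_right: "v \<approx> w \<Longrightarrow> us \<in> lists S \<Longrightarrow> v @ us \<approx> w @ us"
  using coxeter_equiv_ctxt[of S m v w "[]" us] by simp

lemma eqv_trans [trans]: "u \<approx> v \<Longrightarrow> v \<approx> w \<Longrightarrow> u \<approx> w"
  by (rule coxeter_equiv.trans)

lemma eqv_lists: "v \<approx> w \<Longrightarrow> v \<in> lists S" "v \<approx> w \<Longrightarrow> w \<in> lists S"
  using coxeter_equiv_lists by blast+

lemma rev_append_eqv: "w \<in> lists S \<Longrightarrow> rev w @ w \<approx> []"
  by (rule coxeter_equiv_rev) (use diag in auto)

lemma append_rev_eqv: "w \<in> lists S \<Longrightarrow> w @ rev w \<approx> []"
  using rev_append_eqv[of "rev w"] by simp

lemma eqv_cancel_rev: "w \<in> lists S \<Longrightarrow> u \<in> lists S \<Longrightarrow> u @ rev w @ w \<approx> u"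
  using eqv_append_left[OF rev_append_eqv, of w u] by simp

lemma eqv_common: "u \<approx> v \<Longrightarrow> u \<approx> w \<Longrightarrow> v \<approx> w"
  by (rule coxeter_equiv.trans[OF coxeter_equiv.sym])

text \<open>Reversal represents the inverse, as each generator is its own inverse; the claim is
  uniqueness of inverses.\<close>

lemma eqv_rev:
  assumes "v \<approx> w" shows "rev v \<approx> rev w"
proof -
  have l: "rev v \<in> lists S" "rev w \<in> lists S" using eqv_lists[OF assms] by auto
  have "rev v @ v @ rev w \<approx> rev w"
    using eqv_append_right[OF rev_append_eqv l(2), of v] l by simp
  moreover have "rev v @ v @ rev w \<approx> rev v @ w @ rev w"
    using coxeter_equiv_ctxt[OF assms l] .
  moreover have "rev v @ w @ rev w \<approx> rev v"
    using eqv_append_left[OF append_rev_eqv l(1), of w] l by simp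
  ultimately show ?thesis using eqv_common eqv_trans by metis
qed

lemma involution_eqv_rev:
  assumes "w @ w \<approx> []" shows "rev w \<approx> w"
proof -
  have w: "w \<in> lists S" using eqv_lists(1)[OF assms] by simp
  then have "w @ w @ rev w \<approx> rev w"
    using eqv_append_right[OF assms, of "rev w"] by simp
  moreover have "w @ w @ rev w \<approx> w"
    using eqv_append_left[OF append_rev_eqv[OF w] w] by simp
  ultimately show ?thesis by (rule eqv_common)
qed

lemma self_in_cls: "w \<in> lists S \<Longrightarrow> w \<in> cls w"
  by (simp add: coxeter_class_def coxeter_equiv.refl)

lemma cls_eq_iff: "v \<in> lists S \<Longrightarrow> cls v = cls w \<longleftrightarrow> v \<approx> w"
proof
  assume "v \<in> lists S" "cls v = cls w"
  then have "v \<in> cls w" using self_in_cls by blast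
  then show "v \<approx> w" by (simp add: coxeter_class_def coxeter_equiv.sym)
qed (rule coxeter_class_eqI)

lemma len_le: "w \<approx> u \<Longrightarrow> len w \<le> length u"
  unfolding len_def coxeter_length_def coxeter_class_def by (rule Least_le) auto

lemma len_attained:
  assumes "w \<in> lists S" obtains u where "w \<approx> u" "length u = len w"
proof -
  have "\<exists>n. \<exists>u\<in>cls w. length u = n"
    using coxeter_equiv.refl[OF assms, of m] by (auto simp: coxeter_class_def)
  from LeastI_ex[OF this] show ?thesis
    by (auto simp: coxeter_class_def len_def coxeter_length_def intro: that)
qed

lemma len_cong: "v \<approx> w \<Longrightarrow> len v = len w"
  unfolding len_def by (simp add: coxeter_class_eqI)

lemma len_Nil [simp]: "len [] = 0"
  using len_le[OF coxeter_equiv.refl[of "[]"]] by simp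

lemma len_zeroD: "w \<in> lists S \<Longrightarrow> len w = 0 \<Longrightarrow> w \<approx> []"
  using len_attained by (metis length_0_conv)

lemma len_append_le:
  assumes "v \<in> lists S" "w \<in> lists S" shows "len (v @ w) \<le> len v + length w"
proof -
  obtain u where u: "v \<approx> u" "length u = len v" using len_attained[OF assms(1)] .
  then show ?thesis using len_le[OF eqv_append_right[OF u(1) assms(2)]] by simp
qed

lemma len_rev: "w \<in> lists S \<Longrightarrow> len (rev w) = len w"
proof -
  have *: "len (rev w) \<le> len w" if "w \<in> lists S" for w
    by (rule len_attained[OF that]) (use len_le[OF eqv_rev] in fastforce)
  assume "w \<in> lists S"
  then show ?thesis using *[of w] *[of "rev w"] by simp
qed

text \<open>All the relators have even length.\<close>

lemma eqv_parity: "v \<approx> w \<Longrightarrow> even (length v) = even (length w)"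
  by (induction rule: coxeter_equiv.induct)
    (auto simp: length_concat sum_list_replicate map_replicate_const)

lemma len_parity: "w \<in> lists S \<Longrightarrow> even (len w) = even (length w)"
  by (erule len_attained) (simp add: eqv_parity)

lemma len_snoc_neq: "w \<in> lists S \<Longrightarrow> i \<in> S \<Longrightarrow> len (w @ [i]) \<noteq> len w"
  using len_parity[of w] len_parity[of "w @ [i]"] by auto

lemma snoc_snoc_eqv: "w \<in> lists S \<Longrightarrow> i \<in> S \<Longrightarrow> w @ [i, i] \<approx> w"
  using eqv_cancel_rev[of "[i]" w] by simp

lemma len_snoc_ge: "w \<in> lists S \<Longrightarrow> i \<in> S \<Longrightarrow> len w \<le> len (w @ [i]) + 1"
  using len_append_le[of "w @ [i]" "[i]"] len_cong[OF snoc_snoc_eqv, of w i] by simp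

text \<open>Parity excludes equal lengths, and one letter changes the length by at most one.\<close>

lemma len_snoc_cases:
  assumes "w \<in> lists S" "i \<in> S"
  shows "len (w @ [i]) = len w + 1 \<or> len w = len (w @ [i]) + 1"
  using len_append_le[of w "[i]"] len_snoc_ge[of w i] len_snoc_neq[of w i] assms by force

text \<open>The relator followed by \<open>[j, i]\<close> cancels from the left to
  \<open>[j, i]\<close> and from the right to \<open>[i, j]\<close>.\<close>

lemma commute_eqv:
  assumes "i \<in> S" "j \<in> S" "m i j = 2" shows "[i, j] \<approx> [j, i]"
proof -
  have "[i, j, i, j, j, i] \<approx> [j, i]"
    using coxeter_equiv.relation[of i S j "[]" "[j,i]" m] assms by (simp add: numeral_2_eq_2)
  moreover have "[i, j, i, j, j, i] \<approx> [i, j]"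
    using eqv_cancel_rev[of "[j,i]" "[i,j]"] assms by simp
  ultimately show ?thesis using eqv_common by blast
qed

lemma braid_eqv:
  assumes "i \<in> S" "j \<in> S" "m i j = 3" shows "[i, j, i] \<approx> [j, i, j]"
proof -
  have "[i, j, i, j, i, j, j, i, j] \<approx> [j, i, j]"
    using coxeter_equiv.relation[of i S j "[]" "[j,i,j]" m] assms by (simp add: numeral_3_eq_3)
  moreover have "[i, j, i, j, i, j, j, i, j] \<approx> [i, j, i]"
    using eqv_cancel_rev[of "[j,i,j]" "[i,j,i]"] assms by simp
  ultimately show ?thesis using eqv_common by blast
qed

section \<open>The reflection representation and its relation to length\<close>

definition nbr :: "'a \<Rightarrow> 'a set"
  where "nbr i = {j \<in> S. m i j = 3}"

text \<open>In simple-root coordinates this is \<open>v - <v, alpha_i> alpha_i\<close> for the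
  simply laced Cartan form, with 2 on the diagonal and -1 between neighbours.\<close>

definition reflect :: "'a \<Rightarrow> ('a \<Rightarrow> int) \<Rightarrow> 'a \<Rightarrow> int"
  where "reflect i v = v(i := (\<Sum>j\<in>nbr i. v j) - v i)"

primrec act :: "'a list \<Rightarrow> ('a \<Rightarrow> int) \<Rightarrow> 'a \<Rightarrow> int"
  where
    "act [] v = v"
  | "act (i # w) v = reflect i (act w v)"

definition root :: "'a \<Rightarrow> 'a \<Rightarrow> int"
  where "root i = (\<lambda>k. if k = i then 1 else 0)"

lemma finite_nbr [simp]: "finite (nbr i)"
  using fin by (simp add: nbr_def)

lemma not_nbr_self: "i \<in> S \<Longrightarrow> i \<notin> nbr i"
  by (simp add: nbr_def diag)

lemma act_append: "act (v @ w) x = act v (act w x)"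
  by (induction v) auto

lemma reflect_lincomb:
  "reflect i (\<lambda>k. c * x k + d * y k) = (\<lambda>k. c * reflect i x k + d * reflect i y k)"
  by (auto simp: reflect_def fun_eq_iff sum.distrib sum_distrib_left algebra_simps)

lemma act_lincomb: "act w (\<lambda>k. c * x k + d * y k) = (\<lambda>k. c * act w x k + d * act w y k)"
  by (induction w) (auto simp: reflect_lincomb)

lemma act_uminus: "act w (\<lambda>k. - x k) = (\<lambda>k. - act w x k)"
  using act_lincomb[of w "-1" x 0 x] by simp

lemma act_zero: "act w (\<lambda>k. 0) = (\<lambda>k. 0)"
  using act_lincomb[of w 0 "\<lambda>_. 0" 0 "\<lambda>_. 0"] by simp

lemma act_sum:
  "finite A \<Longrightarrow> act w (\<lambda>k. \<Sum>j\<in>A. c j * f j k) = (\<lambda>k. \<Sum>j\<in>A. c j * act w (f j) k)"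
proof (induction A rule: finite_induct)
  case (insert a A)
  then show ?case
    using act_lincomb[of w "c a" "f a" 1 "\<lambda>k. \<Sum>j\<in>A. c j * f j k"] by simp
qed (simp add: act_zero)

lemma act_expand:
  assumes "finite A" "\<And>k. k \<notin> A \<Longrightarrow> v k = 0"
  shows "act w v k = (\<Sum>j\<in>A. v j * act w (root j) k)"
proof -
  have "(\<lambda>k. \<Sum>j\<in>A. v j * root j k) = v"
  proof
    fix k
    have "(\<Sum>j\<in>A. v j * root j k) = (\<Sum>j\<in>A. if j = k then v k else 0)"
      by (intro sum.cong) (auto simp: root_def)
    also have "\<dots> = v k" using assms by simp
    finally show "(\<Sum>j\<in>A. v j * root j k) = v k" .
  qed
  from arg_cong[OF this, of "act w"] show ?thesis
    unfolding act_sum[OF assms(1)] by (metis (no_types))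
qed

text \<open>Each letter changes only its own coordinate. So a word over \<open>J\<close> alters a
  vector only along the simple roots of \<open>J\<close>.\<close>

lemma act_outside: "k \<notin> set w \<Longrightarrow> act w v k = v k"
  by (induction w) (auto simp: reflect_def)

lemma root_simps [simp]: "root i i = 1" "k \<noteq> i \<Longrightarrow> root i k = 0"
  by (auto simp: root_def)

lemma reflect_root_self: "i \<in> S \<Longrightarrow> reflect i (root i) = (\<lambda>k. - root i k)"
  using not_nbr_self[of i] by (auto simp: reflect_def root_def fun_eq_iff)

lemma reflect_root:
  assumes "i \<in> S" "j \<in> S" "i \<noteq> j"
  shows "reflect i (root j) = (if m i j = 3 then (\<lambda>k. root i k + root j k) else root j)"
proof -
  have "(\<Sum>k\<in>nbr i. root j k) = (if m i j = 3 then 1 else 0)"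
    using assms(2) by (simp add: root_def) (simp add: nbr_def)
  then show ?thesis using assms by (auto simp: reflect_def fun_eq_iff root_def)
qed

lemma sum_nbr_upd:
  fixes v :: "'a \<Rightarrow> int"
  shows "(\<Sum>k\<in>nbr i. (v(j := x)) k) = (\<Sum>k\<in>nbr i. v k) + (if j \<in> nbr i then x - v j else 0)"
proof (cases "j \<in> nbr i")
  case True
  then have "(\<Sum>k\<in>nbr i. f k) = f j + (\<Sum>k\<in>nbr i - {j}. f k)" for f :: "'a \<Rightarrow> int"
    by (simp add: sum.remove)
  from this[of v] this[of "v(j := x)"] show ?thesis using True by simp
next
  case False
  then show ?thesis by (auto intro: sum.cong)
qed

text \<open>Only the coordinate at \<open>j\<close> moves. With this, iterated reflections can be
  evaluated coordinate by coordinate.\<close>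

lemma sum_nbr_reflect:
  "(\<Sum>k\<in>nbr i. reflect j v k) =
    (\<Sum>k\<in>nbr i. v k) + (if j \<in> nbr i then (\<Sum>k\<in>nbr j. v k) - 2 * v j else 0)"
  unfolding reflect_def sum_nbr_upd by simp

lemma reflect_same: "reflect i v i = (\<Sum>k\<in>nbr i. v k) - v i"
  by (simp add: reflect_def)

lemma reflect_other: "k \<noteq> i \<Longrightarrow> reflect i v k = v k"
  by (simp add: reflect_def)

lemma reflect_reflect: "i \<in> S \<Longrightarrow> reflect i (reflect i v) = v"
proof
  fix k
  assume "i \<in> S"
  then show "reflect i (reflect i v) k = v k"
    using not_nbr_self[of i]
    by (cases "k = i") (simp_all add: reflect_same reflect_other sum_nbr_reflect)
qed

lemma reflect_commute:
  assumes "i \<in> S" "j \<in> S" "m i j = 2"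
  shows "reflect i (reflect j v) = reflect j (reflect i v)"
proof
  fix k
  have n: "i \<noteq> j" "j \<notin> nbr i" "i \<notin> nbr j"
    using assms diag by (auto simp: nbr_def m_sym[of j i])
  consider "k = i" | "k = j" | "k \<noteq> i" "k \<noteq> j" by blast
  then show "reflect i (reflect j v) k = reflect j (reflect i v) k"
    using n by cases (simp_all add: reflect_same reflect_other sum_nbr_reflect)
qed

text \<open>Both sides of the braid relation are the reflection in the sum of the two roots.\<close>

lemma reflect_conj:
  assumes "i \<in> S" "j \<in> S" "m i j = 3"
  shows "reflect i (reflect j (reflect i v)) = (\<lambda>k. v k +
    ((\<Sum>l\<in>nbr i. v l) + (\<Sum>l\<in>nbr j. v l) - 2 * v i - 2 * v j) * (root i k + root j k))"
    (is "_ = ?r")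
proof
  fix k
  have n: "i \<noteq> j" "j \<in> nbr i" "i \<in> nbr j" "i \<notin> nbr i" "j \<notin> nbr j"
    using assms diag[of i] not_nbr_self by (auto simp: nbr_def m_sym[of j i])
  consider "k = i" | "k = j" | "k \<noteq> i" "k \<noteq> j" by blast
  then show "reflect i (reflect j (reflect i v)) k = ?r k"
    using n by cases (simp_all add: reflect_same reflect_other sum_nbr_reflect)
qed

lemma reflect_braid:
  assumes "i \<in> S" "j \<in> S" "m i j = 3"
  shows "reflect i (reflect j (reflect i v)) = reflect j (reflect i (reflect j v))"
  using assms by (simp add: reflect_conj m_sym[of j i] algebra_simps)

text \<open>The three labels have three reasons: reflections are involutions, nonadjacent ones
  commute, adjacent ones satisfy the braid identity.\<close>

lemma act_relator:
  assumes "i \<in> S" "j \<in> S"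
  shows "act (concat (replicate (m i j) [i, j])) v = v"
proof -
  consider "i = j" | "m i j = 3" | "m i j = 2" using label assms by blast
  then show ?thesis
  proof cases
    case 1
    then show ?thesis using assms by (simp add: diag reflect_reflect)
  next
    case 2
    then show ?thesis
      using assms reflect_braid[of i j "reflect j (reflect i (reflect j v))"]
      by (simp add: numeral_3_eq_3 reflect_reflect)
  next
    case 3
    then show ?thesis
      using assms reflect_commute[of i j "reflect i (reflect j v)"]
      by (simp add: numeral_2_eq_2 reflect_reflect)
  qed
qed

lemma act_cong: "v \<approx> w \<Longrightarrow> act v = act w"
  by (induction rule: coxeter_equiv.induct) (auto simp: act_append act_relator fun_eq_iff)

text \<open>Induction on length. Strip the last letter \<open>j\<close> of a reduced word, so that
  \<open>w\<close> is \<open>v j\<close> with \<open>v\<close> shorter, and write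
  \<open>w alpha_i\<close> as \<open>v (s_j alpha_i)\<close>. For label 2 this is
  \<open>v alpha_i\<close>. For label 3 it is \<open>v alpha_j + v alpha_i\<close>; if
  \<open>v\<close> descends at \<open>i\<close>, a second letter is stripped.\<close>

lemma ascent_nonneg:
  assumes w: "w \<in> lists S" and i: "i \<in> S" and asc: "len w < len (w @ [i])"
  shows "0 \<le> act w (root i) k"
  using w i asc
proof (induction "len w" arbitrary: w i k rule: less_induct)
  case less
  note w = less.prems(1) and i = less.prems(2)
  have sn [simp]: "v @ [a] \<in> lists S" if "v \<in> lists S" "a \<in> S" for v a
    using that by simp
  show ?case
  proof (cases "len w = 0")
    case True
    then show ?thesis using act_cong[OF len_zeroD[OF w]] by (simp add: root_def)
  next
    case False
    obtain u where u: "w \<approx> u" "length u = len w" using len_attained[OF w] .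
    then obtain u' j where uj: "u = u' @ [j]" using False by (cases u rule: rev_cases) auto
    have jS: "j \<in> S" and u'S: "u' \<in> lists S" using eqv_lists(2)[OF u(1)] uj by auto
    define v where "v = w @ [j]"
    have v: "v \<in> lists S" using w jS v_def by simp
    have "v \<approx> u' @ [j, j]" using eqv_append_right[OF u(1), of "[j]"] jS uj v_def by simp
    then have "len v \<le> length u'"
      using len_le eqv_trans snoc_snoc_eqv[OF u'S jS] by blast
    then have lv: "len w = len v + 1" using u(2) uj len_snoc_ge[OF w jS] v_def by simp
    \<comment> \<open>\<open>j\<close> is a descent of \<open>w\<close> by construction, whereas
      \<open>i\<close> is an ascent.\<close>
    then have "j \<noteq> i" using less.prems(3) v_def by auto
    have wv: "w \<approx> v @ [j]" using snoc_snoc_eqv[OF w jS] v_def by (simp add: coxeter_equiv.sym)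
    then have lvj: "len (v @ [j]) = len w" using len_cong by metis
    have wi: "w @ [i] \<approx> v @ [j, i]" using eqv_append_right[OF wv, of "[i]"] i by simp
    have actw: "act w (root i) = act v (reflect j (root i))"
      using act_cong[OF wv] by (simp add: act_append)
    show ?thesis
    proof (cases "m j i = 3")
      case False
      then have m2: "m j i = 2" using label[OF jS i \<open>j \<noteq> i\<close>] by blast
      have "v @ [j, i] \<approx> (v @ [i]) @ [j]"
        using eqv_append_left[OF commute_eqv[OF jS i m2] v] by simp
      then have "len (w @ [i]) = len ((v @ [i]) @ [j])"
        using len_cong eqv_trans[OF wi] by metis
      moreover have "len ((v @ [i]) @ [j]) \<le> len (v @ [i]) + 1"
        using len_append_le[of "v @ [i]" "[j]"] v i jS by simp
      ultimately have "len v < len (v @ [i])" using lv less.prems(3) by linarith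
      then have "0 \<le> act v (root i) k" using less.hyps[of v i k] lv v i by simp
      then show ?thesis using actw reflect_root[OF jS i \<open>j \<noteq> i\<close>] False by simp
    next
      case m3: True
      have actw': "act w (root i) = (\<lambda>k. act v (root j) k + act v (root i) k)"
        using actw reflect_root[OF jS i \<open>j \<noteq> i\<close>] m3 act_lincomb[of v 1 "root j" 1 "root i"] by simp
      show ?thesis
      proof (cases "len v < len (v @ [i])")
        case True
        then have "0 \<le> act v (root i) k" using less.hyps[of v i k] lv v i by simp
        moreover have "0 \<le> act v (root j) k" using less.hyps[of v j k] lv lvj v jS by simp
        ultimately show ?thesis using actw' by simp
      next
        case False
        \<comment> \<open>Now \<open>w\<close> equals \<open>x i j\<close>, and
          \<open>s_i s_j\<close> sends \<open>alpha_i\<close> to \<open>alpha_j\<close>; so it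
          suffices that \<open>x\<close> ascends at \<open>j\<close>.\<close>
        define x where "x = v @ [i]"
        have x: "x \<in> lists S" using v i x_def by simp
        have lx: "len v = len x + 1" using False len_snoc_cases[OF v i] x_def by auto
        have vx: "v \<approx> x @ [i]"
          using snoc_snoc_eqv[OF v i] x_def by (simp add: coxeter_equiv.sym)
        then have "len (x @ [i]) = len v" using len_cong by metis
        then have pi: "0 \<le> act x (root i) k" using less.hyps[of x i k] lx lv x i by simp
        \<comment> \<open>Otherwise the braid relation rewrites \<open>w i = x i j i\<close> as
          \<open>(x j) i j\<close>, of length at most \<open>len x + 1\<close>, although
          \<open>w i\<close> is longer than \<open>w\<close>, whose length is
          \<open>len x + 2\<close>.\<close>
        have "len x < len (x @ [j])"
        proof (rule ccontr)
          assume "\<not> ?thesis"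
          then have lxj: "len x = len (x @ [j]) + 1" using len_snoc_cases[OF x jS] by auto
          have "v @ [j, i] \<approx> x @ [i, j, i]"
            using eqv_append_right[OF vx, of "[j,i]"] jS i by simp
          also have "x @ [i, j, i] \<approx> (x @ [j]) @ [i, j]"
            using eqv_append_left[OF braid_eqv[OF i jS] x] m3 by (simp add: m_sym)
          finally have "len (w @ [i]) = len ((x @ [j]) @ [i, j])"
            using len_cong eqv_trans[OF wi] by metis
          then show False
            using len_append_le[of "x @ [j]" "[i,j]"] x i jS lxj lx lv less.prems(3) by simp
        qed
        then have pj: "0 \<le> act x (root j) k" using less.hyps[of x j k] lx lv x jS by simp
        have "act w (root i) = act x (reflect i (reflect j (root i)))"
          using actw act_cong[OF vx] by (simp add: act_append)
        moreover have "reflect i (reflect j (root i)) = root j"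
          using reflect_root[OF jS i \<open>j \<noteq> i\<close>] reflect_root[OF i jS] reflect_root_self[OF i] \<open>j \<noteq> i\<close> m3
            reflect_lincomb[of i 1 "root j" 1 "root i"] by (simp add: m_sym)
        ultimately show ?thesis using pj by simp
      qed
    qed
  qed
qed

lemma act_rev_act: "w \<in> lists S \<Longrightarrow> act (rev w) (act w v) = v"
  using act_cong[OF rev_append_eqv] by (simp add: act_append fun_eq_iff)

lemma act_root_neq_zero: "w \<in> lists S \<Longrightarrow> \<exists>k. act w (root i) k \<noteq> 0"
proof (rule ccontr)
  assume "w \<in> lists S" "\<nexists>k. act w (root i) k \<noteq> 0"
  then have "act (rev w) (\<lambda>_. 0) = root i" using act_rev_act[of w "root i"] by (metis ext)
  then show False using act_zero root_simps(1) by (metis zero_neq_one)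
qed

text \<open>Appending \<open>i\<close> turns the descent into an ascent, and \<open>s_i\<close>
  negates the simple root at \<open>i\<close>.\<close>

lemma descent_nonpos:
  assumes "w \<in> lists S" "i \<in> S" "len (w @ [i]) < len w"
  shows "act w (root i) k \<le> 0"
proof -
  have "len (w @ [i]) < len ((w @ [i]) @ [i])"
    using assms len_cong[OF snoc_snoc_eqv[OF assms(1,2)]] by simp
  then have "0 \<le> act (w @ [i]) (root i) k"
    using ascent_nonneg[of "w @ [i]" i k] assms by simp
  then show ?thesis using assms by (simp add: act_append reflect_root_self act_uminus)
qed

lemma len_snoc_less_or_greater:
  "w \<in> lists S \<Longrightarrow> i \<in> S \<Longrightarrow> len w < len (w @ [i]) \<or> len (w @ [i]) < len w"
  using len_snoc_neq by force

text \<open>For the converse, a vector both nonnegative and nonpositive is zero, which an invertible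
  action excludes.\<close>

lemma ascent_iff:
  assumes "w \<in> lists S" "i \<in> S"
  shows "len w < len (w @ [i]) \<longleftrightarrow> (\<forall>k. 0 \<le> act w (root i) k)"
  using len_snoc_less_or_greater[OF assms] ascent_nonneg[OF assms] descent_nonpos[OF assms]
    act_root_neq_zero[OF assms(1)] by (meson order_antisym_conv)

lemma descent_iff:
  assumes "w \<in> lists S" "i \<in> S"
  shows "len (w @ [i]) < len w \<longleftrightarrow> (\<forall>k. act w (root i) k \<le> 0)"
  using len_snoc_less_or_greater[OF assms] ascent_nonneg[OF assms] descent_nonpos[OF assms]
    act_root_neq_zero[OF assms(1)] by (meson order_antisym)

lemma root_sign:
  assumes "w \<in> lists S" "i \<in> S"
  shows "(\<forall>k. 0 \<le> act w (root i) k) \<or> (\<forall>k. act w (root i) k \<le> 0)"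
  using len_snoc_less_or_greater[OF assms] ascent_iff[OF assms] descent_iff[OF assms] by blast

text \<open>The last letter of a reduced word for a nontrivial \<open>w\<close> would be a
  descent.\<close>

lemma no_descent_trivial:
  assumes w: "w \<in> lists S" and pos: "\<And>i. i \<in> S \<Longrightarrow> \<exists>k. 0 < act w (root i) k"
  shows "w \<approx> []"
proof (rule ccontr)
  assume "\<not> w \<approx> []"
  then have "len w \<noteq> 0" using len_zeroD[OF w] by blast
  obtain u where u: "w \<approx> u" "length u = len w" using len_attained[OF w] .
  then obtain u' j where uj: "u = u' @ [j]" using \<open>len w \<noteq> 0\<close> by (cases u rule: rev_cases) auto
  have jS: "j \<in> S" and u'S: "u' \<in> lists S" using eqv_lists(2)[OF u(1)] uj by auto
  have "w @ [j] \<approx> u' @ [j, j]" using eqv_append_right[OF u(1), of "[j]"] jS uj by simp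
  then have "len (w @ [j]) \<le> length u'"
    using len_le eqv_trans snoc_snoc_eqv[OF u'S jS] by blast
  then have "len (w @ [j]) < len w" using u(2) uj by simp
  then show False using descent_nonpos[OF w jS] pos[OF jS] by (meson leD)
qed

text \<open>Faithfulness of the action: \<open>rev v @ w\<close> fixes every simple root, so it has
  no descent.\<close>

lemma eqvI:
  assumes v: "v \<in> lists S" and w: "w \<in> lists S"
    and eq: "\<And>i. i \<in> S \<Longrightarrow> act v (root i) = act w (root i)"
  shows "v \<approx> w"
proof -
  have "act (rev v @ w) (root i) = root i" if "i \<in> S" for i
    using eq[OF that] act_rev_act[OF v] by (simp add: act_append) metis
  then have "rev v @ w \<approx> []"
    using v w by (intro no_descent_trivial) (simp, metis root_simps(1) zero_less_one)
  then have "v @ rev v @ w \<approx> v" using eqv_append_left[OF _ v] by fastforce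
  moreover have "v @ rev v @ w \<approx> w" using eqv_append_right[OF append_rev_eqv[OF v] w] by simp
  ultimately show ?thesis by (rule eqv_common)
qed

text \<open>By linearity \<open>c\<close> reverses the sign of every vector of constant sign
  supported on \<open>I\<close>. Prepending \<open>i\<close> to \<open>u\<close> therefore changes
  the lengths of \<open>u\<close> and of \<open>c @ rev u\<close> by one in opposite
  directions.\<close>

lemma len_longest:
  assumes I: "I \<subseteq> S" and c: "c \<in> lists I"
    and neg: "\<And>i k. i \<in> I \<Longrightarrow> act c (root i) k \<le> 0" and u: "u \<in> lists I"
  shows "len (c @ rev u) + len u = len c"
  using u
proof (induction u)
  case (Cons i u)
  then have i: "i \<in> I" "i \<in> S" and u: "u \<in> lists I" using I by auto
  have S: "c \<in> lists S" "u \<in> lists S" using c u I lists_mono by blast+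
  let ?x = "c @ rev u"
  have supp: "act (rev u) (root i) k = 0" if "k \<notin> I" for k
    using act_outside[of k "rev u"] that u i by (auto simp: root_def in_lists_conv_set)
  have expand: "act ?x (root i) k = (\<Sum>j\<in>I. act (rev u) (root i) j * act c (root j) k)" for k
    using act_expand[OF finite_subset[OF I fin] supp] by (simp add: act_append)
  have lu: "len (i # u) = len (rev u @ [i])" using len_rev[of "i # u"] i S by simp
  show ?case
  proof (cases "len (rev u) < len (rev u @ [i])")
    case True
    then have "act ?x (root i) k \<le> 0" for k
      unfolding expand using neg ascent_iff[of "rev u" i] S i
      by (intro sum_nonpos) (simp add: mult_nonneg_nonpos)
    then have "len (?x @ [i]) < len ?x" using descent_iff[of ?x i] S i by simp
    then have "len ?x = len (?x @ [i]) + 1" using len_snoc_cases[of ?x i] S i by auto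
    moreover have "len (i # u) = len u + 1"
      using True len_snoc_cases[of "rev u" i] S i lu len_rev by auto
    ultimately show ?thesis using Cons.IH by simp
  next
    case False
    then have *: "len (rev u @ [i]) < len (rev u)"
      using len_snoc_less_or_greater[of "rev u" i] S i by simp
    then have "0 \<le> act ?x (root i) k" for k
      unfolding expand using neg descent_iff[of "rev u" i] S i
      by (intro sum_nonneg) (simp add: mult_nonpos_nonpos)
    then have "len ?x < len (?x @ [i])" using ascent_iff[of ?x i] S i by simp
    then have "len (?x @ [i]) = len ?x + 1" using len_snoc_cases[of ?x i] S i by auto
    moreover have "len u = len (i # u) + 1"
      using * len_snoc_cases[of "rev u" i] S i lu len_rev by auto
    ultimately show ?thesis using Cons.IH by simp
  qed
qed simp

text \<open>\<open>len_longest\<close> bounds all lengths by that of \<open>c\<close>; equality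
  leaves \<open>c @ rev u\<close> with length zero, which gives the uniqueness demanded by
  \<open>THE\<close>.\<close>

lemma longest_element_eq:
  assumes I: "I \<subseteq> S" and c: "c \<in> lists I"
    and neg: "\<And>i k. i \<in> I \<Longrightarrow> act c (root i) k \<le> 0"
  shows "longest_element (cls ` lists I) = cls c"
  unfolding longest_element_def
proof (rule the_equality)
  have S: "lists I \<subseteq> lists S" using I by (rule lists_mono)
  have le: "len u \<le> len c" if "u \<in> lists I" for u
    using len_longest[OF I c neg that] by simp
  then show "cls c \<in> cls ` lists I \<and> (\<forall>v\<in>cls ` lists I. coxeter_length v \<le> coxeter_length (cls c))"
    using c by (auto simp: len_def)
  fix x
  assume x: "x \<in> cls ` lists I \<and> (\<forall>v\<in>cls ` lists I. coxeter_length v \<le> coxeter_length x)"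
  then obtain u where u: "u \<in> lists I" "x = cls u" by blast
  then have "len c \<le> len u" using x c by (auto simp: len_def)
  then have "len (c @ rev u) = 0" using len_longest[OF I c neg u(1)] le[OF u(1)] by simp
  then have "c @ rev u \<approx> []" using len_zeroD[of "c @ rev u"] c u(1) S by auto
  then have "c @ rev u @ u \<approx> u" using eqv_append_right[of _ _ u] u(1) S by fastforce
  moreover have "c @ rev u @ u \<approx> c" using eqv_cancel_rev c u(1) S by auto
  ultimately show "x = cls c" using u(2) coxeter_class_eqI eqv_common by metis
qed

text \<open>The coordinate at \<open>k\<close> is not touched by the letters of
  \<open>i # t\<close>, so it stays negative and \<open>i\<close> is still a descent of
  \<open>(i # t) @ w\<close>. Appending \<open>i\<close> then shortens, and \<open>t\<close> adds
  back at most its length, for a total drop of at least two.\<close>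

lemma involution_shorten:
  assumes inv: "w @ w \<approx> []" and t: "i # t \<in> lists S" and rev_t: "rev (i # t) \<approx> i # t"
    and len: "len (w @ i # t) + length (i # t) = len w"
    and neg: "\<And>k. act w (root i) k \<le> 0" and out: "k \<notin> set (i # t)" "act w (root i) k \<noteq> 0"
  shows "len ((i # t) @ w @ (i # t)) < len w"
proof -
  let ?t = "i # t"
  have w: "w \<in> lists S" using eqv_lists[OF inv] by simp
  have tw: "?t @ w \<in> lists S" "i \<in> S" "t \<in> lists S" using w t by auto
  have "act (?t @ w) (root i) k < 0"
    unfolding act_append using act_outside[OF out(1)] neg[of k] out(2) by simp
  then have "\<forall>k. act (?t @ w) (root i) k \<le> 0" using root_sign[OF tw(1,2)] by (meson leD)
  then have "len ((?t @ w) @ [i]) < len (?t @ w)" using descent_iff[OF tw(1,2)] by blast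
  \<comment> \<open>The two words are inverse to each other, since \<open>w\<close> and
    \<open>i # t\<close> are involutions.\<close>
  moreover have "len (?t @ w) = len (w @ ?t)"
  proof -
    have "rev (w @ ?t) \<approx> ?t @ w"
      unfolding rev_append using coxeter_equiv_append[OF rev_t involution_eqv_rev[OF inv]] .
    then show ?thesis using len_cong len_rev[of "w @ ?t"] w t by auto
  qed
  moreover have "len (((?t @ w) @ [i]) @ t) \<le> len ((?t @ w) @ [i]) + length t"
    using len_append_le[of "(?t @ w) @ [i]" t] tw by simp
  ultimately show ?thesis using len by simp
qed

text \<open>The product \<open>w @ c\<close> has no descent. On \<open>J\<close> both factors send
  simple roots to negatives of simple roots, and the signs cancel. Outside \<open>J\<close> a
  positive coordinate off \<open>J\<close> survives, because \<open>c\<close> only adds multiples of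
  roots in \<open>J\<close>.\<close>

lemma involution_eqv_longest:
  assumes inv: "w @ w \<approx> []" and J: "J \<subseteq> S"
    and wJ: "\<And>j. j \<in> J \<Longrightarrow> \<exists>k\<in>J. act w (root j) = (\<lambda>l. - root k l)"
    and asc: "\<And>j l. j \<in> S - J \<Longrightarrow> 0 \<le> act w (root j) l"
    and c: "c \<in> lists J" and cJ: "\<And>j. j \<in> J \<Longrightarrow> \<exists>k\<in>J. act c (root j) = (\<lambda>l. - root k l)"
  shows "w \<approx> rev c"
proof -
  have w: "w \<in> lists S" using eqv_lists[OF inv] by simp
  have cS: "c \<in> lists S" using c J lists_mono by blast
  have finJ: "finite J" using J fin by (rule finite_subset)
  have wJ0: "act w (root k) l = 0" if "k \<in> J" "l \<notin> J" for k l
    using wJ[OF that(1)] that(2) by (auto simp: root_def)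
  have "w @ c \<approx> []"
  proof (rule no_descent_trivial)
    show "w @ c \<in> lists S" using w cS by simp
    fix j assume j: "j \<in> S"
    show "\<exists>k. 0 < act (w @ c) (root j) k"
    proof (cases "j \<in> J")
      case True
      obtain k where k: "k \<in> J" "act c (root j) = (\<lambda>l. - root k l)" using cJ[OF True] by blast
      obtain k' where k': "act w (root k) = (\<lambda>l. - root k' l)" using wJ[OF k(1)] by blast
      have "act (w @ c) (root j) k' = 1" by (simp add: act_append k k' act_uminus)
      then show ?thesis by (intro exI[of _ k']) simp
    next
      case False
      \<comment> \<open>If the image of the root at \<open>j\<close> were supported on
        \<open>J\<close>, so would be its image under \<open>w\<close>, which is the root at
        \<open>j\<close> again.\<close>
      have "\<exists>l. l \<notin> J \<and> act w (root j) l \<noteq> 0"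
      proof (rule ccontr)
        assume "\<nexists>l. l \<notin> J \<and> act w (root j) l \<noteq> 0"
        then have "act w (act w (root j)) j = (\<Sum>k\<in>J. act w (root j) k * act w (root k) j)"
          by (intro act_expand[OF finJ]) blast
        also have "\<dots> = 0" using wJ0 False by (intro sum.neutral) simp
        finally show False using act_cong[OF inv] by (simp add: act_append fun_eq_iff)
      qed
      then obtain l where l: "l \<notin> J" "act w (root j) l \<noteq> 0" by blast
      then have pos: "0 < act w (root j) l" using asc[of j l] j False by force
      have supp: "act c (root j) k = 0" if "k \<notin> insert j J" for k
        using act_outside[of k c] that c by (auto simp: root_def in_lists_conv_set)
      \<comment> \<open>\<open>w\<close> keeps the span of \<open>J\<close>, so only the term at
        \<open>j\<close> contributes to the coordinate \<open>l\<close>.\<close>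
      have "act (w @ c) (root j) l = (\<Sum>k\<in>insert j J. act c (root j) k * act w (root k) l)"
        unfolding act_append by (intro act_expand) (use finJ supp in auto)
      also have "\<dots> = act c (root j) j * act w (root j) l"
        using finJ False wJ0 l(1) by simp
      also have "act c (root j) j = 1" using act_outside[of j c] c False by (auto simp: in_lists_conv_set)
      finally show ?thesis using pos by (intro exI[of _ l]) simp
    qed
  qed
  then have "w @ c @ rev c \<approx> rev c" using eqv_append_right[of "w @ c" "[]" "rev c"] cS by simp
  moreover have "w @ c @ rev c \<approx> w" using eqv_append_left[OF append_rev_eqv[OF cS] w] by simp
  ultimately show ?thesis using eqv_common by blast
qed

section \<open>The group of classes of words and its parabolic subgroups\<close>

abbreviation W :: "'a list set monoid"
  where "W \<equiv> coxeter_group S m"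

lemma group_W: "group W"
  using group_coxeter_group[of S m] diag by blast

lemma carrier_W: "carrier W = cls ` lists S"
  by (simp add: coxeter_group_def)

lemma one_W: "\<one>\<^bsub>W\<^esub> = cls []"
  by (simp add: coxeter_group_def)

lemma inv_cls: "w \<in> lists S \<Longrightarrow> inv\<^bsub>W\<^esub> (cls w) = cls (rev w)"
  using group_W coxeter_class_eqI[OF rev_append_eqv]
  by (intro group.inv_equality) (simp_all add: coxeter_mult_class one_W carrier_W)

lemma generate_eq:
  assumes "I \<subseteq> S" shows "generate W ((\<lambda>i. cls [i]) ` I) = cls ` lists I"
proof
  have S: "lists I \<subseteq> lists S" using assms by (rule lists_mono)
  show "generate W ((\<lambda>i. cls [i]) ` I) \<subseteq> cls ` lists I"
  proof
    fix x assume "x \<in> generate W ((\<lambda>i. cls [i]) ` I)"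
    then show "x \<in> cls ` lists I"
    proof (induction rule: generate.induct)
      case one
      then show ?case by (auto simp: one_W)
    next
      case (incl h)
      then show ?case by auto
    next
      case (inv h)
      then show ?case using assms by (auto simp: inv_cls subset_iff)
    next
      case (eng h1 h2)
      then obtain u v where "u \<in> lists I" "v \<in> lists I" "h1 = cls u" "h2 = cls v" by blast
      then have "u @ v \<in> lists I" "h1 \<otimes>\<^bsub>W\<^esub> h2 = cls (u @ v)"
        using S by (auto simp: coxeter_mult_class subset_iff)
      then show ?case by blast
    qed
  qed
  show "cls ` lists I \<subseteq> generate W ((\<lambda>i. cls [i]) ` I)"
  proof
    fix x assume "x \<in> cls ` lists I"
    then obtain w where "w \<in> lists I" "x = cls w" by blast
    then show "x \<in> generate W ((\<lambda>i. cls [i]) ` I)"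
    proof (induction w arbitrary: x rule: lists.induct)
      case Nil
      then show ?case using generate.one[of W] by (simp add: one_W)
    next
      case (Cons i w)
      note iw = Cons.hyps
      have "cls [i] \<otimes>\<^bsub>W\<^esub> cls w \<in> generate W ((\<lambda>i. cls [i]) ` I)"
        using iw Cons.IH by (intro generate.eng[OF generate.incl] imageI) simp_all
      moreover have "cls [i] \<otimes>\<^bsub>W\<^esub> cls w = cls (i # w)"
        using iw assms S by (subst coxeter_mult_class) auto
      ultimately show ?case using Cons.prems by simp
    qed
  qed
qed

section \<open>The trace as a class function\<close>

definition trace :: "'a list \<Rightarrow> int"
  where "trace w = (\<Sum>i\<in>S. act w (root i) i)"

lemma act_root_outside:
  "w \<in> lists S \<Longrightarrow> i \<in> S \<Longrightarrow> k \<notin> S \<Longrightarrow> act w (root i) k = 0"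
  using act_outside[of k w "root i"] by (auto simp: root_def in_lists_conv_set)

lemma trace_append:
  assumes "v \<in> lists S" "w \<in> lists S"
  shows "trace (v @ w) = (\<Sum>i\<in>S. \<Sum>k\<in>S. act w (root i) k * act v (root k) i)"
  unfolding trace_def act_append
proof (intro sum.cong[OF HOL.refl] act_expand[OF fin])
  show "act w (root i) k = 0" if "i \<in> S" "k \<notin> S" for i k
    by (rule act_root_outside[OF assms(2) that])
qed

lemma trace_commute:
  assumes "v \<in> lists S" "w \<in> lists S" shows "trace (v @ w) = trace (w @ v)"
  unfolding trace_append[OF assms] trace_append[OF assms(2,1)]
  by (subst sum.swap) (simp add: mult.commute)

lemma trace_cong: "v \<approx> w \<Longrightarrow> trace v = trace w"
  by (simp add: trace_def act_cong)

lemma trace_conj: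
  assumes "g \<in> lists S" "w \<in> lists S" shows "trace (g @ w @ rev g) = trace w"
proof -
  have "trace (g @ w @ rev g) = trace (w @ rev g @ g)"
    using trace_commute[of g "w @ rev g"] assms by simp
  also have "\<dots> = trace w" using eqv_cancel_rev[OF assms] by (rule trace_cong)
  finally show ?thesis .
qed

end

section \<open>Computing in type \<open>E\<^sub>6\<close>\<close>

type_synonym vec6 = "int \<times> int \<times> int \<times> int \<times> int \<times> int"

fun reflect6 :: "nat \<Rightarrow> vec6 \<Rightarrow> vec6"
  where "reflect6 i (a, b, c, d, e, f) =
    (if i = 1 then (c - a, b, c, d, e, f)
     else if i = 2 then (a, d - b, c, d, e, f)
     else if i = 3 then (a, b, a + d - c, d, e, f)
     else if i = 4 then (a, b, c, b + c + e - d, e, f)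
     else if i = 5 then (a, b, c, d, d + f - e, f)
     else (a, b, c, d, e, e - f))"

fun vec :: "vec6 \<Rightarrow> nat \<Rightarrow> int"
  where "vec (a, b, c, d, e, f) k =
    (if k = 1 then a else if k = 2 then b else if k = 3 then c
     else if k = 4 then d else if k = 5 then e else if k = 6 then f else 0)"

fun neg6 :: "vec6 \<Rightarrow> vec6"
  where "neg6 (a, b, c, d, e, f) = (- a, - b, - c, - d, - e, - f)"

definition unit6 :: "nat \<Rightarrow> vec6"
  where "unit6 i = (of_bool (i = 1), of_bool (i = 2), of_bool (i = 3),
    of_bool (i = 4), of_bool (i = 5), of_bool (i = 6))"

definition act6 :: "nat list \<Rightarrow> vec6 \<Rightarrow> vec6"
  where "act6 w x = foldr reflect6 w x"

definition nodes_list :: "nat list"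
  where "nodes_list = [1, 2, 3, 4, 5, 6]"

definition mat6 :: "nat list \<Rightarrow> vec6 list"
  where "mat6 w = map (\<lambda>i. act6 w (unit6 i)) nodes_list"

definition trace6 :: "nat list \<Rightarrow> int"
  where "trace6 w = sum_list (map (\<lambda>i. vec (act6 w (unit6 i)) i) nodes_list)"

text \<open>An evaluable test for equality in the group, sound by faithfulness. The letters are
  checked because \<open>reflect6\<close> treats every number outside 1 to 5 as node 6.\<close>

definition same :: "nat list \<Rightarrow> nat list \<Rightarrow> bool"
  where "same v w \<longleftrightarrow> list_all (\<lambda>i. i \<in> set nodes_list) v \<and> list_all (\<lambda>i. i \<in> set nodes_list) w
    \<and> mat6 v = mat6 w"

interpretation E6: simply_laced E6_nodes E6_matrix
proof
  show "E6_matrix i j = E6_matrix j i" for i j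
    by (simp add: E6_matrix_def insert_commute)
qed (auto simp: E6_nodes_def E6_matrix_def)

abbreviation E6_eqv (infix "\<approx>" 50)
  where "v \<approx> w \<equiv> coxeter_equiv E6_nodes E6_matrix v w"

abbreviation cls :: "nat list \<Rightarrow> nat list set"
  where "cls \<equiv> coxeter_class E6_nodes E6_matrix"

lemma set_nodes_list: "set nodes_list = E6_nodes"
  by (simp add: nodes_list_def E6_nodes_def)

lemma E6_nbr:
  "E6.nbr 1 = {3}" "E6.nbr 2 = {4}" "E6.nbr 3 = {1, 4}"
  "E6.nbr 4 = {2, 3, 5}" "E6.nbr 5 = {4, 6}" "E6.nbr 6 = {5}"
proof -
  have "j \<in> E6.nbr i \<longleftrightarrow> j \<in> E6_nodes \<and> E6_matrix i j = 3" for i j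
    by (simp add: E6.nbr_def)
  then show "E6.nbr 1 = {3}" "E6.nbr 2 = {4}" "E6.nbr 3 = {1, 4}"
    "E6.nbr 4 = {2, 3, 5}" "E6.nbr 5 = {4, 6}" "E6.nbr 6 = {5}"
    by (auto simp: E6_nodes_def E6_matrix_def E6_edges_def doubleton_eq_iff)
qed

lemma reflect_vec: "i \<in> E6_nodes \<Longrightarrow> E6.reflect i (vec x) = vec (reflect6 i x)"
proof (cases x)
  case (fields a b c d e f)
  assume "i \<in> E6_nodes"
  then consider "i = 1" | "i = 2" | "i = 3" | "i = 4" | "i = 5" | "i = 6"
    by (auto simp: E6_nodes_def)
  then show ?thesis
    \<comment> \<open>Simplification rewrites \<open>1\<close> to \<open>Suc 0\<close>, so the
      equation for node 1 is supplied in that form as well.\<close>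
    by cases (simp_all add: fields fun_eq_iff E6.reflect_def E6_nbr E6_nbr(1)[simplified])
qed

lemma act_vec: "w \<in> lists E6_nodes \<Longrightarrow> E6.act w (vec x) = vec (act6 w x)"
  by (induction w) (auto simp: act6_def reflect_vec)

lemma root_vec: "i \<in> E6_nodes \<Longrightarrow> E6.root i = vec (unit6 i)"
  by (auto simp: E6_nodes_def unit6_def E6.root_def fun_eq_iff)

lemma act_root_vec:
  "w \<in> lists E6_nodes \<Longrightarrow> i \<in> E6_nodes \<Longrightarrow> E6.act w (E6.root i) = vec (act6 w (unit6 i))"
  by (simp add: root_vec act_vec)

lemma vec_neg6: "vec (neg6 x) = (\<lambda>k. - vec x k)"
  by (cases x) (auto simp: fun_eq_iff)

lemma vec_inject: "vec x = vec y \<longleftrightarrow> x = y"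
proof
  assume "vec x = vec y"
  then have "\<forall>k\<in>{1,2,3,4,5,6}. vec x k = vec y k" by simp
  then show "x = y" by (cases x; cases y) simp
qed simp

lemma sameD:
  assumes "same v w" shows "v \<in> lists E6_nodes" "w \<in> lists E6_nodes" "v \<approx> w"
proof -
  show vw: "v \<in> lists E6_nodes" "w \<in> lists E6_nodes"
    using assms by (auto simp: same_def list_all_iff set_nodes_list in_lists_conv_set)
  show "v \<approx> w"
  proof (rule E6.eqvI[OF vw])
    fix i assume "i \<in> E6_nodes"
    moreover from this have "act6 v (unit6 i) = act6 w (unit6 i)"
      using assms unfolding same_def mat6_def set_nodes_list[symmetric] by simp
    ultimately show "E6.act v (E6.root i) = E6.act w (E6.root i)"
      using vw by (simp add: act_root_vec)
  qed
qed

lemma trace_trace6: "w \<in> lists E6_nodes \<Longrightarrow> E6.trace w = trace6 w"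
proof -
  assume w: "w \<in> lists E6_nodes"
  have "distinct nodes_list" by (simp add: nodes_list_def)
  then have "trace6 w = (\<Sum>i\<in>E6_nodes. vec (act6 w (unit6 i)) i)"
    by (simp add: trace6_def sum_list_distinct_conv_sum_set set_nodes_list)
  then show ?thesis unfolding E6.trace_def by (simp add: act_root_vec w)
qed

text \<open>A reduced word built along the nodes 1 to \<open>k\<close>: the prefixes using only
  these nodes have 1, 2, 4, 10, 20 and 36 letters, the numbers of positive roots of the
  corresponding parabolic subgroups.\<close>

definition wo_word :: "nat list"
  where "wo_word = [1, 2, 3, 1, 4, 2, 3, 1, 4, 3, 5, 4, 2, 3, 1, 4, 3, 5, 4, 2, 6, 5, 4, 2, 3, 1, 4, 3,
    5, 4, 2, 6, 5, 4, 3, 1]"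

text \<open>All \<open>flip\<close>-stable \<open>J\<close>, with words for \<open>w\<^sub>J\<close>. In the last four, \<open>w\<^sub>J\<close> sends some simple root
  \<open>j\<close> in \<open>J\<close> to neither minus \<open>j\<close> nor minus \<open>flip j\<close>.\<close>

definition longest_words :: "(nat list \<times> nat list) list"
  where "longest_words =
   [([], []),
    ([1, 6], [1, 6]),
    ([3, 5], [3, 5]),
    ([2], [2]),
    ([4], [4]),
    ([1, 6, 2], [1, 2, 6]),
    ([1, 6, 4], [1, 4, 6]),
    ([3, 5, 2], [2, 3, 5]),
    ([3, 5, 4], [3, 4, 3, 5, 4, 3]),
    ([3, 5, 2, 4], [2, 3, 4, 2, 3, 4, 5, 4, 2, 3, 4, 5]),
    ([1, 6, 3, 5, 4], [1, 3, 1, 4, 3, 1, 5, 4, 3, 1, 6, 5, 4, 3, 1]),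
    ([1, 6, 3, 5, 2, 4], wo_word),
    ([1, 6, 3, 5], [1, 3, 1, 5, 6, 5]),
    ([1, 6, 3, 5, 2], [1, 2, 3, 1, 5, 6, 5]),
    ([2, 4], [2, 4, 2]),
    ([1, 6, 2, 4], [1, 2, 4, 2, 6])]"

definition flip :: "nat \<Rightarrow> nat"
  where "flip i = (if i = 1 then 6 else if i = 6 then 1 else if i = 3 then 5 else if i = 5 then 3 else i)"

lemmas compute6 = act6_def unit6_def mat6_def nodes_list_def same_def wo_word_def flip_def

text \<open>Invariance under reversal later replaces \<open>rev c\<close> by \<open>c\<close>; the
  action on the simple roots of \<open>J\<close> identifies \<open>c\<close> as the longest
  element.\<close>

lemma longest_words_check:
  "list_all (\<lambda>(js, c). same c (rev c) \<and> list_all (\<lambda>i. i \<in> set js) c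
    \<and> list_all (\<lambda>j. list_ex (\<lambda>k. act6 c (unit6 j) = neg6 (unit6 k)) js) js) longest_words"
  by (simp add: longest_words_def compute6)

section \<open>Involutions commuting with the longest element\<close>

definition Wo_word :: "nat list \<Rightarrow> bool"
  where "Wo_word w \<longleftrightarrow> w \<in> lists E6_nodes \<and> wo_word @ w \<approx> w @ wo_word"

lemma Wo_word_lists: "Wo_word w \<Longrightarrow> w \<in> lists E6_nodes"
  by (simp add: Wo_word_def)

lemma Wo_wordI: "same (wo_word @ w) (w @ wo_word) \<Longrightarrow> Wo_word w"
  using sameD[of "wo_word @ w" "w @ wo_word"] by (simp add: Wo_word_def)

lemma wo_word_lists: "wo_word \<in> lists E6_nodes"
  by (simp add: wo_word_def E6_nodes_def)

lemma Wo_word_append: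
  assumes "Wo_word v" "Wo_word w" shows "Wo_word (v @ w)"
proof -
  have "wo_word @ v @ w \<approx> v @ wo_word @ w"
    using E6.eqv_append_right[of "wo_word @ v" "v @ wo_word" w] assms by (simp add: Wo_word_def)
  moreover have "v @ wo_word @ w \<approx> v @ w @ wo_word"
    using E6.eqv_append_left[of "wo_word @ w" "w @ wo_word" v] assms by (simp add: Wo_word_def)
  ultimately show ?thesis using assms E6.eqv_trans by (auto simp: Wo_word_def)
qed

lemma Wo_word_rev:
  assumes "Wo_word w" shows "Wo_word (rev w)"
proof -
  have w: "w \<in> lists E6_nodes" "rev w \<in> lists E6_nodes" using Wo_word_lists[OF assms] by simp_all
  have "rev w @ (wo_word @ w) @ rev w \<approx> rev w @ (w @ wo_word) @ rev w"
    using coxeter_equiv_ctxt[OF _ w(2) w(2)] assms by (simp only: Wo_word_def)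
  moreover have "rev w @ (wo_word @ w) @ rev w \<approx> rev w @ wo_word"
    using E6.eqv_append_left[OF E6.append_rev_eqv[OF w(1)], of "rev w @ wo_word"] w wo_word_lists
    by simp
  moreover have "rev w @ (w @ wo_word) @ rev w \<approx> wo_word @ rev w"
    using E6.eqv_append_right[OF E6.rev_append_eqv[OF w(1)], of "wo_word @ rev w"] w wo_word_lists
    by simp
  ultimately have "wo_word @ rev w \<approx> rev w @ wo_word"
    by (meson E6.eqv_common E6.eqv_trans)
  then show ?thesis using w by (simp add: Wo_word_def)
qed

lemma Wo_word_cong:
  assumes "Wo_word v" "v \<approx> w" shows "Wo_word w"
proof -
  have "wo_word @ v \<approx> wo_word @ w" "v @ wo_word \<approx> w @ wo_word"
    using assms(2) wo_word_lists by (simp_all add: E6.eqv_append_left E6.eqv_append_right)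
  moreover have "wo_word @ v \<approx> v @ wo_word" using assms by (simp add: Wo_word_def)
  ultimately have "wo_word @ w \<approx> w @ wo_word" by (meson E6.eqv_common E6.eqv_trans)
  then show ?thesis using E6.eqv_lists[OF assms(2)] by (simp add: Wo_word_def)
qed

section \<open>The diagram automorphism and the action of W_o\<close>

lemma flip_nodes: "i \<in> E6_nodes \<Longrightarrow> flip i \<in> E6_nodes"
  by (auto simp: E6_nodes_def flip_def)

lemma flip_flip [simp]: "flip (flip i) = i"
  by (simp add: flip_def)

lemma root_flip: "E6.root (flip i) k = E6.root i (flip k)"
  using flip_flip by (metis E6.root_def)

lemma act_wo_root:
  assumes "i \<in> E6_nodes" shows "E6.act wo_word (E6.root i) = (\<lambda>k. - E6.root (flip i) k)"
proof -
  have "list_all (\<lambda>i. act6 wo_word (unit6 i) = neg6 (unit6 (flip i))) nodes_list"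
    by (simp add: compute6)
  then have "act6 wo_word (unit6 i) = neg6 (unit6 (flip i))"
    using assms by (simp add: list_all_iff set_nodes_list)
  then show ?thesis
    using assms by (simp add: act_root_vec wo_word_lists vec_neg6 flip_nodes root_vec[of "flip i"])
qed

lemma act_wo:
  assumes "\<And>k. k \<notin> E6_nodes \<Longrightarrow> v k = 0"
  shows "E6.act wo_word v k = - v (flip k)"
proof -
  have "E6.act wo_word v k = (\<Sum>j\<in>E6_nodes. v j * E6.act wo_word (E6.root j) k)"
    using assms by (intro E6.act_expand E6.fin)
  also have "\<dots> = (\<Sum>j\<in>E6_nodes. if j = flip k then - v j else 0)"
    by (intro sum.cong HOL.refl) (auto simp: act_wo_root root_flip)
  also have "\<dots> = - v (flip k)"
    using assms[of "flip k"] E6.fin by (simp add: sum.delta)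
  finally show ?thesis .
qed

text \<open>\<open>w\<close> commutes with the longest element, which acts by \<open>-flip\<close>;
  cancelling the sign, it commutes with \<open>flip\<close>.\<close>

lemma act_root_flip:
  assumes "Wo_word w" "i \<in> E6_nodes"
  shows "E6.act w (E6.root (flip i)) k = E6.act w (E6.root i) (flip k)"
proof -
  have "E6.act wo_word (E6.act w (E6.root i)) = E6.act w (E6.act wo_word (E6.root i))"
    using E6.act_cong[of "wo_word @ w" "w @ wo_word"] assms(1)
    by (simp add: Wo_word_def E6.act_append fun_eq_iff)
  then have "- E6.act w (E6.root i) (flip k) = - E6.act w (E6.root (flip i)) k"
    using act_wo[of "E6.act w (E6.root i)" k] E6.act_root_outside[OF Wo_word_lists[OF assms(1)] assms(2)]
    by (simp add: act_wo_root assms(2) E6.act_uminus)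
  then show ?thesis by simp
qed

lemma Wo_generators: "i \<in> {2, 4} \<Longrightarrow> Wo_word [i]"
  "i \<in> {1, 3, 5, 6} \<Longrightarrow> Wo_word [i, flip i]"
  by (rule Wo_wordI, auto simp: compute6)+

lemma one_sum_squares:
  fixes a b :: int assumes "a * a + b * b = 1" shows "a = 0 \<or> b = 0"
proof (rule ccontr)
  assume "\<not> ?thesis"
  then have "1 \<le> a\<^sup>2" "1 \<le> b\<^sup>2" by (simp_all add: int_one_le_iff_zero_less)
  then show False using assms by (simp add: power2_eq_square)
qed

lemma int_square_one:
  fixes a :: int assumes "a * a = 1" "a \<le> 0" shows "a = -1"
  using assms zmult_eq_1_iff by auto

text \<open>The factor \<open>t\<close> is \<open>i\<close> if \<open>flip\<close> fixes
  \<open>i\<close>, and \<open>i\<close> times \<open>flip i\<close> otherwise.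
  \<open>E6.involution_shorten\<close> applies once the image of the root has a coordinate off the
  letters of \<open>t\<close>; without one, \<open>w\<close> being an involution forces an excluded
  value.\<close>

lemma Wo_involution_shorten:
  assumes w: "Wo_word w" and inv: "w @ w \<approx> []" and i: "i \<in> E6_nodes"
    and neg: "\<And>k. E6.act w (E6.root i) k \<le> 0"
    and ne: "E6.act w (E6.root i) \<noteq> (\<lambda>k. - E6.root i k)"
      "E6.act w (E6.root i) \<noteq> (\<lambda>k. - E6.root (flip i) k)"
  shows "\<exists>t. Wo_word t \<and> rev t \<approx> t \<and> E6.len (t @ w @ t) < E6.len w"
proof -
  let ?v = "E6.act w (E6.root i)" and ?j = "flip i"
  note wS = Wo_word_lists[OF w]
  have vv: "E6.act w ?v = E6.root i" using E6.act_cong[OF inv] by (simp add: E6.act_append fun_eq_iff)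
  have desc: "E6.len (w @ [i]) + 1 = E6.len w"
    using E6.descent_iff[OF wS i] neg E6.len_snoc_cases[OF wS i] by auto
  show ?thesis
  proof (cases "?j = i")
    case True
    then have "i \<in> {2, 4}" using i by (auto simp: E6_nodes_def flip_def)
    then have Wi: "Wo_word [i]" by (rule Wo_generators)
    have "\<exists>k. k \<noteq> i \<and> ?v k \<noteq> 0"
    proof (rule ccontr)
      assume *: "\<nexists>k. k \<noteq> i \<and> ?v k \<noteq> 0"
      then have "E6.act w ?v i = (\<Sum>j\<in>{i}. ?v j * E6.act w (E6.root j) i)"
        by (intro E6.act_expand) auto
      then have "?v i = -1" using int_square_one neg[of i] unfolding vv by simp
      then have "?v = (\<lambda>k. - E6.root i k)" using * by (auto simp: E6.root_def fun_eq_iff)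
      then show False using ne(1) by blast
    qed
    then obtain k where "k \<noteq> i" "?v k \<noteq> 0" by blast
    then have "E6.len ([i] @ w @ [i]) < E6.len w"
      using desc neg i by (intro E6.involution_shorten[OF inv]) (auto intro: coxeter_equiv.refl)
    then show ?thesis using Wi i by (intro exI[of _ "[i]"]) (simp add: coxeter_equiv.refl)
  next
    case False
    then have i4: "i \<in> {1, 3, 5, 6}" using i by (auto simp: E6_nodes_def flip_def)
    then have Wi: "Wo_word [i, ?j]" by (rule Wo_generators)
    have j: "?j \<in> E6_nodes" using i by (rule flip_nodes)
    have m2: "E6_matrix i ?j = 2"
      using i4 by (auto simp: flip_def E6_matrix_def E6_edges_def doubleton_eq_iff)
    have out: "\<exists>k. k \<noteq> i \<and> k \<noteq> ?j \<and> ?v k \<noteq> 0"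
    proof (rule ccontr)
      assume *: "\<nexists>k. k \<noteq> i \<and> k \<noteq> ?j \<and> ?v k \<noteq> 0"
      \<comment> \<open>Let the image have coordinates \<open>a\<close> at \<open>i\<close> and
        \<open>b\<close> at \<open>flip i\<close>. They are exchanged in the image of the root at
        \<open>flip i\<close>, so applying \<open>w\<close> twice gives
        \<open>a * a + b * b = 1\<close>.\<close>
      then have "E6.act w ?v i = (\<Sum>j\<in>{i, ?j}. ?v j * E6.act w (E6.root j) i)"
        by (intro E6.act_expand) auto
      then have sq: "?v i * ?v i + ?v ?j * ?v ?j = 1"
        using False act_root_flip[OF w i, of i] unfolding vv by simp
      from one_sum_squares[OF sq] show False
      proof
        assume "?v i = 0"
        moreover from this have "?v ?j = -1" using sq int_square_one neg[of ?j] by simp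
        ultimately have "?v = (\<lambda>k. - E6.root ?j k)" using * by (auto simp: E6.root_def fun_eq_iff)
        then show False using ne(2) by blast
      next
        assume "?v ?j = 0"
        moreover from this have "?v i = -1" using sq int_square_one neg[of i] by simp
        ultimately have "?v = (\<lambda>k. - E6.root i k)" using * by (auto simp: E6.root_def fun_eq_iff)
        then show False using ne(1) by blast
      qed
    qed
    \<comment> \<open>\<open>s_i\<close> fixes the orthogonal root at \<open>flip i\<close>, and its
      image under \<open>w\<close> is the flipped, hence nonpositive, image of the root at
      \<open>i\<close>. So both letters shorten.\<close>
    have "E6.act (w @ [i]) (E6.root ?j) k \<le> 0" for k
      using neg[of "flip k"] act_root_flip[OF w i, of k] E6.reflect_root[OF i j] False m2
      by (auto simp: E6.act_append)
    then have "E6.len ((w @ [i]) @ [?j]) < E6.len (w @ [i])"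
      using E6.descent_iff[of "w @ [i]" ?j] wS i j by simp
    then have desc2: "E6.len (w @ [i, ?j]) + 2 = E6.len w"
      using E6.len_snoc_cases[of "w @ [i]" ?j] wS i j desc by auto
    have rev_t: "rev [i, ?j] \<approx> [i, ?j]"
      using E6.commute_eqv[OF i j m2] by (simp add: coxeter_equiv.sym)
    obtain k where "k \<noteq> i" "k \<noteq> ?j" "?v k \<noteq> 0" using out by blast
    then have "E6.len ([i, ?j] @ w @ [i, ?j]) < E6.len w"
      using desc2 neg i j rev_t by (intro E6.involution_shorten[OF inv]) auto
    then show ?thesis using Wi rev_t by blast
  qed
qed

text \<open>The filter is the condition that \<open>Wo_involution_shorten\<close> leaves on the
  descents of an involution it cannot shorten.\<close>

definition central_words :: "nat list list"
  where "central_words = map snd (filter (\<lambda>(js, c).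
    list_all (\<lambda>j. act6 c (unit6 j) = neg6 (unit6 j) \<or> act6 c (unit6 j) = neg6 (unit6 (flip j))) js)
    longest_words)"

lemma central_words_eq: "central_words = map snd (take 12 longest_words)"
  by (simp add: central_words_def longest_words_def compute6)

lemma flip_invariant_cases:
  assumes J: "J \<subseteq> E6_nodes" and flip: "\<And>i. i \<in> J \<Longrightarrow> flip i \<in> J"
  shows "\<exists>(js, c)\<in>set longest_words. set js = J"
proof -
  have "6 \<in> J \<longleftrightarrow> 1 \<in> J" using flip[of 1] flip[of 6] by (auto simp: flip_def)
  moreover have "5 \<in> J \<longleftrightarrow> 3 \<in> J" using flip[of 3] flip[of 5] by (auto simp: flip_def)
  ultimately have "J = set ((if 1 \<in> J then [1, 6] else []) @ (if 3 \<in> J then [3, 5] else []) @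
      (if 2 \<in> J then [2] else []) @ (if 4 \<in> J then [4] else []))"
    using J unfolding E6_nodes_def by auto
  \<comment> \<open>A \<open>flip\<close>-stable set is determined by which of 1, 3, 2, 4 it
    contains; abstracting these memberships to Booleans gives sixteen cases.\<close>
  then obtain a b c d where "J = set ((if a then [1, 6] else []) @ (if b then [3, 5] else []) @
      (if c then [2] else []) @ (if d then [4] else []))" by blast
  then show ?thesis
    by (cases a; cases b; cases c; cases d) (simp_all add: longest_words_def)
qed

lemma longest_wordsD:
  assumes "(js, c) \<in> set longest_words"
  shows "same c (rev c)" "set c \<subseteq> set js" "set js \<subseteq> E6_nodes"
    "j \<in> set js \<Longrightarrow> \<exists>k\<in>set js. E6.act c (E6.root j) = (\<lambda>l. - E6.root k l)"
proof -
  have js: "list_all (\<lambda>(js, c). list_all (\<lambda>j. j \<in> set nodes_list) js) longest_words"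
    by (simp add: longest_words_def nodes_list_def)
  then show S: "set js \<subseteq> E6_nodes"
    using assms by (auto simp: list_all_iff set_nodes_list)
  note chk = longest_words_check[unfolded list_all_iff list_ex_iff, rule_format, OF assms, simplified]
  then show s: "same c (rev c)" and "set c \<subseteq> set js" by auto
  show "\<exists>k\<in>set js. E6.act c (E6.root j) = (\<lambda>l. - E6.root k l)" if j: "j \<in> set js"
  proof -
    obtain k where k: "k \<in> set js" "act6 c (unit6 j) = neg6 (unit6 k)" using chk j by blast
    then have "j \<in> E6_nodes" "k \<in> E6_nodes" using j S by auto
    then have "E6.act c (E6.root j) = (\<lambda>l. - E6.root k l)"
      by (simp add: act_root_vec sameD(1)[OF s] root_vec[of k] k(2) vec_neg6)
    then show ?thesis using k(1) by blast
  qed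
qed

text \<open>Let \<open>J\<close> be the set of descents, which is stable under \<open>flip\<close>.
  Every root in \<open>J\<close> goes to minus itself or minus its flip, so \<open>w\<close> agrees
  with the listed word for \<open>J\<close>. That word acts like \<open>w\<close> and therefore
  passes the filter.\<close>

lemma Wo_involution_unshortenable:
  assumes w: "Wo_word w" and inv: "w @ w \<approx> []"
    and min: "\<And>t. Wo_word t \<Longrightarrow> rev t \<approx> t \<Longrightarrow> \<not> E6.len (t @ w @ t) < E6.len w"
  shows "\<exists>c\<in>set central_words. w \<approx> c"
proof -
  note wS = Wo_word_lists[OF w]
  define J where "J = {i \<in> E6_nodes. \<forall>k. E6.act w (E6.root i) k \<le> 0}"
  have J: "J \<subseteq> E6_nodes" by (auto simp: J_def)
  have Jflip: "flip i \<in> J" if "i \<in> J" for i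
    using that act_root_flip[OF w] flip_nodes by (auto simp: J_def)
  have wJ: "E6.act w (E6.root j) = (\<lambda>l. - E6.root j l) \<or> E6.act w (E6.root j) = (\<lambda>l. - E6.root (flip j) l)"
    if "j \<in> J" for j
    using Wo_involution_shorten[OF w inv, of j] that min by (auto simp: J_def)
  obtain js c where jc: "(js, c) \<in> set longest_words" "set js = J"
    using flip_invariant_cases[OF J Jflip] by blast
  note c = longest_wordsD[OF jc(1)]
  have "w \<approx> rev c"
  proof (rule E6.involution_eqv_longest[OF inv J])
    show "\<exists>k\<in>J. E6.act w (E6.root j) = (\<lambda>l. - E6.root k l)" if "j \<in> J" for j
      using wJ[OF that] Jflip[OF that] that by blast
    show "0 \<le> E6.act w (E6.root j) l" if "j \<in> E6_nodes - J" for j l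
      using E6.root_sign[OF wS, of j] that by (auto simp: J_def)
    show "c \<in> lists J" using c(2) jc(2) by auto
    show "\<exists>k\<in>J. E6.act c (E6.root j) = (\<lambda>l. - E6.root k l)" if "j \<in> J" for j
      using c(4) jc(2) that by blast
  qed
  then have wc: "w \<approx> c" using sameD(3)[OF c(1)] E6.eqv_trans coxeter_equiv.sym by metis
  have "act6 c (unit6 j) = neg6 (unit6 j) \<or> act6 c (unit6 j) = neg6 (unit6 (flip j))"
    if j: "j \<in> set js" for j
  proof -
    have jn: "j \<in> E6_nodes" "flip j \<in> E6_nodes" using j c(3) flip_nodes by auto
    have "E6.act w (E6.root j) = vec (act6 c (unit6 j))"
      using E6.act_cong[OF wc] act_root_vec[OF sameD(1)[OF c(1)] jn(1)] by simp
    then show ?thesis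
      using wJ[of j] j jc(2) root_vec[OF jn(1)] root_vec[OF jn(2)]
      by (simp add: vec_neg6[symmetric] vec_inject)
  qed
  then have "c \<in> set central_words"
    using jc(1) by (force simp: central_words_def list_all_iff)
  then show ?thesis using wc by blast
qed

definition Wo_conj :: "nat list \<Rightarrow> nat list \<Rightarrow> bool"
  where "Wo_conj u v \<longleftrightarrow> (\<exists>g. Wo_word g \<and> g @ u @ rev g \<approx> v)"

text \<open>Since \<open>t\<close> is its own inverse, \<open>t @ w @ t\<close> is a shorter
  conjugate of \<open>w\<close> and again an involution in W_o; the descent ends in
  \<open>central_words\<close>.\<close>

lemma Wo_involution_conj_central:
  "Wo_word w \<Longrightarrow> w @ w \<approx> [] \<Longrightarrow> \<exists>c\<in>set central_words. Wo_conj w c"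
proof (induction "E6.len w" arbitrary: w rule: less_induct)
  case less
  note w = less.prems(1) and wS = Wo_word_lists[OF less.prems(1)]
  show ?case
  proof (cases "\<exists>t. Wo_word t \<and> rev t \<approx> t \<and> E6.len (t @ w @ t) < E6.len w")
    case False
    then obtain c where "c \<in> set central_words" "w \<approx> c"
      using Wo_involution_unshortenable[OF less.prems] by blast
    moreover have "Wo_word []" by (simp add: Wo_word_def coxeter_equiv.refl wo_word_lists)
    ultimately show ?thesis
      unfolding Wo_conj_def by (intro bexI[of _ c] exI[of _ "[]"]) simp_all
  next
    case True
    then obtain t where t: "Wo_word t" "rev t \<approx> t" "E6.len (t @ w @ t) < E6.len w" by blast
    have tS: "t \<in> lists E6_nodes" using Wo_word_lists[OF t(1)] .
    let ?w = "t @ w @ t"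
    have W: "Wo_word ?w" using t(1) w by (simp add: Wo_word_append)
    have tt: "t @ t \<approx> []"
      using E6.eqv_append_right[OF t(2) tS] E6.rev_append_eqv[OF tS] E6.eqv_common by metis
    have "t @ w @ (t @ t) @ w @ t \<approx> t @ (w @ w) @ t"
      using coxeter_equiv_ctxt[OF tt, of "t @ w" "w @ t"] tS wS by simp
    also have "t @ (w @ w) @ t \<approx> t @ t"
      using coxeter_equiv_ctxt[OF less.prems(2) tS tS] by simp
    also note tt
    finally have "?w @ ?w \<approx> []" by simp
    then obtain c g where cg: "c \<in> set central_words" "Wo_word g" "g @ ?w @ rev g \<approx> c"
      using less.hyps[OF t(3) W] unfolding Wo_conj_def by blast
    have gS: "g \<in> lists E6_nodes" using Wo_word_lists[OF cg(2)] .
    have "(g @ t) @ w @ rev (g @ t) \<approx> (g @ t @ w) @ t @ rev g"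
      using coxeter_equiv_ctxt[OF t(2), of "g @ t @ w" "rev g"] gS tS wS by simp
    then have "(g @ t) @ w @ rev (g @ t) \<approx> c"
      using cg(3) E6.eqv_trans by (metis append.assoc)
    then show ?thesis using cg t Wo_word_append unfolding Wo_conj_def by blast
  qed
qed

section \<open>Conjugacy classes\<close>

definition Wo_class :: "nat list \<Rightarrow> nat list set set"
  where "Wo_class u = conj_class E6_Wo (cls u)"

lemma E6_parabolic_eq: "I \<subseteq> E6_nodes \<Longrightarrow> E6_parabolic I = cls ` lists I"
  using E6.generate_eq[of I] unfolding E6_parabolic_def E6_group_def E6_simple_def .

lemma longest_element_longest_words:
  assumes "(js, c) \<in> set longest_words"
  shows "longest_element (cls ` lists (set js)) = cls c"
proof (rule E6.longest_element_eq)
  note c = longest_wordsD[OF assms]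
  show "set js \<subseteq> E6_nodes" "c \<in> lists (set js)" using c by auto
  show "E6.act c (E6.root i) k \<le> 0" if "i \<in> set js" for i k
    using c(4)[OF that] by (auto simp: E6.root_def)
qed

lemma E6_long_eq: "(js, c) \<in> set longest_words \<Longrightarrow> E6_long (set js) = cls c"
  unfolding E6_long_def
  by (subst E6_parabolic_eq, erule longest_wordsD(3)) (rule longest_element_longest_words)

lemma E6_wo_eq: "E6_wo = cls wo_word"
proof -
  have "set [1, 6, 3, 5, 2, 4] = E6_nodes" by (auto simp: E6_nodes_def)
  then have "longest_element (cls ` lists E6_nodes) = cls wo_word"
    using longest_element_longest_words[of "[1, 6, 3, 5, 2, 4]" wo_word] by (simp add: longest_words_def)
  then show ?thesis by (simp add: E6_wo_def E6_group_def E6.carrier_W)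
qed

lemma E6_mult: "v \<in> lists E6_nodes \<Longrightarrow> w \<in> lists E6_nodes \<Longrightarrow> cls v \<otimes>\<^bsub>E6_group\<^esub> cls w = cls (v @ w)"
  unfolding E6_group_def by (rule coxeter_mult_class)

lemma mult_Wo [simp]: "x \<otimes>\<^bsub>E6_Wo\<^esub> y = x \<otimes>\<^bsub>E6_group\<^esub> y"
  by (simp add: E6_Wo_def)

lemma carrier_Wo: "carrier E6_Wo = cls ` Collect Wo_word"
proof -
  have "cls w \<otimes>\<^bsub>E6_group\<^esub> E6_wo = E6_wo \<otimes>\<^bsub>E6_group\<^esub> cls w \<longleftrightarrow> Wo_word w"
    if "w \<in> lists E6_nodes" for w
    using that wo_word_lists E6.cls_eq_iff[of "w @ wo_word" "wo_word @ w"]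
    by (auto simp: E6_wo_eq E6_mult Wo_word_def coxeter_equiv.sym)
  then show ?thesis
    using Wo_word_lists by (auto simp: E6_Wo_def E6_group_def E6.carrier_W)
qed

lemma one_Wo: "\<one>\<^bsub>E6_Wo\<^esub> = cls []"
  by (simp add: E6_Wo_def E6_group_def E6.one_W)

text \<open>This lets inverses in \<open>E6_Wo\<close> be taken in the full group, where they are
  reversals.\<close>

lemma subgroup_Wo: "subgroup (carrier E6_Wo) E6_group"
proof -
  interpret group E6_group unfolding E6_group_def by (rule E6.group_W)
  show ?thesis
  proof (rule subgroupI)
    show "carrier E6_Wo \<subseteq> carrier E6_group" by (auto simp: E6_Wo_def)
    show "carrier E6_Wo \<noteq> {}"
      using Wo_wordI[of "[]"] unfolding carrier_Wo by (auto simp: compute6)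
    show "inv\<^bsub>E6_group\<^esub> a \<in> carrier E6_Wo" if "a \<in> carrier E6_Wo" for a
      using that Wo_word_lists Wo_word_rev unfolding carrier_Wo
      by (auto simp: E6_group_def E6.inv_cls)
    show "a \<otimes>\<^bsub>E6_group\<^esub> b \<in> carrier E6_Wo" if "a \<in> carrier E6_Wo" "b \<in> carrier E6_Wo" for a b
      using that Wo_word_lists Wo_word_append unfolding carrier_Wo by (auto simp: E6_mult)
  qed
qed

lemma inv_Wo: "Wo_word w \<Longrightarrow> inv\<^bsub>E6_Wo\<^esub> (cls w) = cls (rev w)"
proof -
  assume w: "Wo_word w"
  interpret group E6_group unfolding E6_group_def by (rule E6.group_W)
  have "E6_Wo = E6_group\<lparr>carrier := carrier E6_Wo\<rparr>" by (simp add: E6_Wo_def)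
  then have "inv\<^bsub>E6_Wo\<^esub> (cls w) = inv\<^bsub>E6_group\<^esub> (cls w)"
    using m_inv_consistent[OF subgroup_Wo, of "cls w"] w unfolding carrier_Wo by simp
  then show ?thesis using Wo_word_lists[OF w] by (simp add: E6_group_def E6.inv_cls)
qed

text \<open>The conjugation map in \<open>conj_class\<close> is undefined off the carrier, which is
  why \<open>u\<close> has to represent an element of W_o.\<close>

lemma Wo_class_eq:
  assumes "Wo_word u" shows "Wo_class u = {cls (g @ u @ rev g) | g. Wo_word g}"
proof -
  have *: "(\<lambda>h\<in>carrier E6_Wo. cls g \<otimes>\<^bsub>E6_Wo\<^esub> h \<otimes>\<^bsub>E6_Wo\<^esub> inv\<^bsub>E6_Wo\<^esub> (cls g)) (cls u) = cls (g @ u @ rev g)"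
    if "Wo_word g" for g
    using that assms Wo_word_lists by (auto simp: inv_Wo E6_mult carrier_Wo)
  show ?thesis
    unfolding Wo_class_def conj_class_def orbit_def using * by (force simp: carrier_Wo simp del: restrict_apply)
qed

lemma Wo_conj_word: "Wo_word u \<Longrightarrow> Wo_conj u v \<Longrightarrow> Wo_word v"
  unfolding Wo_conj_def by (elim exE conjE) (erule Wo_word_cong[rotated], intro Wo_word_append Wo_word_rev)

lemma Wo_conj_sym:
  assumes u: "Wo_word u" and uv: "Wo_conj u v" shows "Wo_conj v u"
proof -
  obtain g where g: "Wo_word g" "g @ u @ rev g \<approx> v" using uv by (auto simp: Wo_conj_def)
  have S: "g \<in> lists E6_nodes" "rev g \<in> lists E6_nodes" "u \<in> lists E6_nodes"
    using g u Wo_word_lists by simp_all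
  have "rev g @ (g @ u @ rev g) @ g \<approx> rev g @ v @ g"
    by (rule coxeter_equiv_ctxt[OF g(2) S(2,1)])
  moreover have "rev g @ (g @ u @ rev g) @ g \<approx> rev g @ g @ u"
    using E6.eqv_cancel_rev[OF S(1), of "rev g @ g @ u"] S by simp
  moreover have "rev g @ g @ u \<approx> u"
    using E6.eqv_append_right[OF E6.rev_append_eqv[OF S(1)] S(3)] by simp
  ultimately have "rev g @ v @ rev (rev g) \<approx> u"
    unfolding rev_rev_ident by (rule E6.eqv_trans[OF E6.eqv_common])
  then show ?thesis unfolding Wo_conj_def using Wo_word_rev[OF g(1)] by (intro exI conjI)
qed

lemma Wo_conj_trans:
  assumes "Wo_conj u v" "Wo_conj v w" shows "Wo_conj u w"
proof -
  obtain g where g: "Wo_word g" "g @ u @ rev g \<approx> v" using assms(1) by (auto simp: Wo_conj_def)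
  obtain h where h: "Wo_word h" "h @ v @ rev h \<approx> w" using assms(2) by (auto simp: Wo_conj_def)
  have "h @ (g @ u @ rev g) @ rev h \<approx> h @ v @ rev h"
    using coxeter_equiv_ctxt[OF g(2)] Wo_word_lists[OF h(1)] by simp
  then have "(h @ g) @ u @ rev (h @ g) \<approx> w" using h(2) E6.eqv_trans by fastforce
  then show ?thesis unfolding Wo_conj_def using Wo_word_append g(1) h(1) by blast
qed

lemma mem_Wo_class:
  assumes "Wo_word u" "Wo_word v" shows "cls v \<in> Wo_class u \<longleftrightarrow> Wo_conj u v"
proof -
  have "cls v = cls (g @ u @ rev g) \<longleftrightarrow> g @ u @ rev g \<approx> v" if "Wo_word g" for g
    using E6.cls_eq_iff[of "g @ u @ rev g" v] that assms Wo_word_lists by auto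
  then show ?thesis unfolding Wo_class_eq[OF assms(1)] Wo_conj_def by blast
qed

lemma Wo_class_subset: "Wo_word u \<Longrightarrow> Wo_class u \<subseteq> cls ` Collect Wo_word"
  by (auto simp: Wo_class_eq intro!: imageI Wo_word_append Wo_word_rev)

lemma Wo_class_eq_iff:
  assumes u: "Wo_word u" and v: "Wo_word v" shows "Wo_class u = Wo_class v \<longleftrightarrow> Wo_conj u v"
proof
  have "Wo_conj v v"
    unfolding Wo_conj_def using Wo_wordI[of "[]"] Wo_word_lists[OF v]
    by (intro exI[of _ "[]"]) (auto simp: compute6 coxeter_equiv.refl)
  then show "Wo_conj u v" if "Wo_class u = Wo_class v"
    using that mem_Wo_class u v by blast
  assume uv: "Wo_conj u v"
  have "cls w \<in> Wo_class u \<longleftrightarrow> cls w \<in> Wo_class v" if "Wo_word w" for w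
    unfolding mem_Wo_class[OF u that] mem_Wo_class[OF v that]
    using uv Wo_conj_sym[OF u uv] Wo_conj_trans by blast
  then show "Wo_class u = Wo_class v"
    using Wo_class_subset[OF u] Wo_class_subset[OF v] by blast
qed

text \<open>Once a conjugator is supplied, equality of classes reduces to three evaluable
  tests.\<close>

lemma Wo_class_eqI:
  "same (wo_word @ g) (g @ wo_word) \<Longrightarrow> same (wo_word @ u) (u @ wo_word) \<Longrightarrow>
    same (g @ u @ rev g) v \<Longrightarrow> Wo_class u = Wo_class v"
proof -
  assume g: "same (wo_word @ g) (g @ wo_word)" and u: "same (wo_word @ u) (u @ wo_word)"
    and v: "same (g @ u @ rev g) v"
  have "Wo_conj u v" unfolding Wo_conj_def using Wo_wordI[OF g] sameD(3)[OF v] by blast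
  then show ?thesis using Wo_class_eq_iff Wo_wordI[OF u] Wo_conj_word by blast
qed

lemma E6_cl_eq: "(js, c) \<in> set longest_words \<Longrightarrow> E6_cl (set js) = Wo_class c"
  unfolding E6_cl_def Wo_class_def by (drule E6_long_eq) simp

text \<open>The longest element is central in W_o, so it moves past the conjugator
  \<open>g\<close>.\<close>

lemma wo_times_Wo_class:
  assumes "Wo_word u" shows "E6_wo_times (Wo_class u) = Wo_class (wo_word @ u)"
proof -
  have W: "Wo_word wo_word" by (simp add: Wo_word_def wo_word_lists coxeter_equiv.refl)
  have "E6_wo \<otimes>\<^bsub>E6_Wo\<^esub> cls (g @ u @ rev g) = cls (g @ (wo_word @ u) @ rev g)" if g: "Wo_word g" for g
  proof -
    have S: "u @ rev g \<in> lists E6_nodes" "g \<in> lists E6_nodes"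
      using assms g Wo_word_lists by auto
    then have "cls ((wo_word @ g) @ u @ rev g) = cls ((g @ wo_word) @ u @ rev g)"
      using E6.eqv_append_right g unfolding Wo_word_def by (intro coxeter_class_eqI) blast
    then show ?thesis using S wo_word_lists by (simp add: E6_wo_eq E6_mult)
  qed
  then show ?thesis
    unfolding E6_wo_times_def l_coset_def Wo_class_eq[OF assms] Wo_class_eq[OF Wo_word_append[OF W assms]]
    by (auto; (blast)?)
qed

text \<open>Conjugate words have equal traces; applied to the translates by the longest element,
  this yields the second invariant.\<close>

lemma Wo_class_trace:
  assumes u: "Wo_word u" and v: "Wo_word v" and eq: "Wo_class u = Wo_class v"
  shows "trace6 u = trace6 v" "trace6 (wo_word @ u) = trace6 (wo_word @ v)"
proof -
  have W: "Wo_word wo_word" by (simp add: Wo_word_def wo_word_lists coxeter_equiv.refl)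
  have *: "trace6 u = trace6 v" if uv: "Wo_word u" "Wo_word v" "Wo_class u = Wo_class v" for u v
  proof -
    obtain g where g: "Wo_word g" "g @ u @ rev g \<approx> v"
      using Wo_class_eq_iff[OF uv(1,2)] uv(3) unfolding Wo_conj_def by blast
    then show ?thesis
      using E6.trace_conj[of g u] E6.trace_cong[OF g(2)] uv Wo_word_lists by (simp add: trace_trace6)
  qed
  show "trace6 u = trace6 v" using * u v eq .
  have "Wo_class (wo_word @ u) = Wo_class (wo_word @ v)"
    using wo_times_Wo_class[OF u] wo_times_Wo_class[OF v] eq by simp
  then show "trace6 (wo_word @ u) = trace6 (wo_word @ v)"
    using * Wo_word_append[OF W] u v by blast
qed

lemma Wo_class_trace_inj:
  assumes "\<And>u. u \<in> set us \<Longrightarrow> Wo_word u"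
    and "distinct (map (\<lambda>u. (trace6 u, trace6 (wo_word @ u))) us)"
  shows "distinct (map Wo_class us)"
  unfolding distinct_map
proof
  show "distinct us" using assms(2) by (simp add: distinct_map)
  show "inj_on Wo_class (set us)"
  proof (rule inj_onI)
    fix u v assume uv: "u \<in> set us" "v \<in> set us" "Wo_class u = Wo_class v"
    then have "trace6 u = trace6 v" "trace6 (wo_word @ u) = trace6 (wo_word @ v)"
      using Wo_class_trace[OF assms(1) assms(1)] by blast+
    then show "u = v" using assms(2) uv(1,2) by (simp add: distinct_map inj_on_def)
  qed
qed

text \<open>One inclusion is the shortening argument. For the other, evaluation shows that the
  twelve words are involutions commuting with the longest element.\<close>

lemma conj_classes_involutions:
  "conj_class E6_Wo ` involutions E6_Wo = Wo_class ` set central_words"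
proof
  show "conj_class E6_Wo ` involutions E6_Wo \<subseteq> Wo_class ` set central_words"
  proof
    fix C assume "C \<in> conj_class E6_Wo ` involutions E6_Wo"
    then obtain w where w: "Wo_word w" "C = Wo_class w" "cls w \<otimes>\<^bsub>E6_Wo\<^esub> cls w = cls []"
      by (auto simp: involutions_def carrier_Wo one_Wo Wo_class_def)
    then have "w @ w \<approx> []"
      using Wo_word_lists[OF w(1)] E6.cls_eq_iff[of "w @ w" "[]"] by (simp add: E6_mult)
    then obtain c where "c \<in> set central_words" "Wo_conj w c"
      using Wo_involution_conj_central w(1) by blast
    then show "C \<in> Wo_class ` set central_words"
      using w(2) Wo_class_eq_iff[OF w(1) Wo_conj_word[OF w(1)]] by blast
  qed
  have "list_all (\<lambda>c. same (wo_word @ c) (c @ wo_word) \<and> same (c @ c) []) central_words"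
    by (simp add: central_words_eq longest_words_def compute6)
  then have "Wo_word c \<and> c @ c \<approx> []" if "c \<in> set central_words" for c
    using that Wo_wordI sameD(3) by (auto simp: list_all_iff)
  then have "cls c \<in> involutions E6_Wo" if "c \<in> set central_words" for c
    using that Wo_word_lists coxeter_class_eqI[of _ _ "c @ c" "[]"]
    by (auto simp: involutions_def carrier_Wo one_Wo E6_mult)
  then show "Wo_class ` set central_words \<subseteq> conj_class E6_Wo ` involutions E6_Wo"
    by (auto simp: Wo_class_def)
qed

lemma longest_words_Wo: "(js, c) \<in> set longest_words \<Longrightarrow> Wo_word c"
proof -
  have "list_all (\<lambda>(js, c). same (wo_word @ c) (c @ wo_word)) longest_words"
    by (simp add: longest_words_def compute6)
  then show "(js, c) \<in> set longest_words \<Longrightarrow> Wo_word c"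
    using Wo_wordI by (auto simp: list_all_iff)
qed

lemma E6_long_Wo:
  assumes "(js, c) \<in> set longest_words" "I = set js" shows "E6_long I \<in> carrier E6_Wo"
  using E6_long_eq[OF assms(1)] longest_words_Wo[OF assms(1)] assms(2) by (simp add: carrier_Wo)

lemma E6_cl_eqI: "(js, c) \<in> set longest_words \<Longrightarrow> I = set js \<Longrightarrow> E6_cl I = Wo_class c"
  using E6_cl_eq by simp

section \<open>The eight classes and their translation by the longest element\<close>

definition A5_word :: "nat list"
  where "A5_word = [1, 3, 1, 4, 3, 1, 5, 4, 3, 1, 6, 5, 4, 3, 1]"

definition D4_word :: "nat list"
  where "D4_word = [2, 3, 4, 2, 3, 4, 5, 4, 2, 3, 4, 5]"

lemma longest_words_mem:
  "([], []) \<in> set longest_words"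
  "([1, 6], [1, 6]) \<in> set longest_words"
  "([3, 5], [3, 5]) \<in> set longest_words"
  "([2], [2]) \<in> set longest_words"
  "([4], [4]) \<in> set longest_words"
  "([1, 6, 2], [1, 2, 6]) \<in> set longest_words"
  "([1, 6, 4], [1, 4, 6]) \<in> set longest_words"
  "([3, 5, 4], [3, 4, 3, 5, 4, 3]) \<in> set longest_words"
  "([3, 5, 2, 4], D4_word) \<in> set longest_words"
  "([1, 6, 3, 5, 4], A5_word) \<in> set longest_words"
  "([1, 6, 3, 5, 2, 4], wo_word) \<in> set longest_words"
  by (simp_all add: longest_words_def A5_word_def D4_word_def)

lemma E6_cl_words:
  "E6_cl {} = Wo_class []"
  "E6_cl {1, 2, 3, 4, 5, 6} = Wo_class wo_word"
  "E6_cl {2} = Wo_class [2]"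
  "E6_cl {4} = Wo_class [4]"
  "E6_cl {1, 3, 4, 5, 6} = Wo_class A5_word"
  "E6_cl {1, 6} = Wo_class [1, 6]"
  "E6_cl {3, 5} = Wo_class [3, 5]"
  "E6_cl {2, 3, 4, 5} = Wo_class D4_word"
  "E6_cl {1, 4, 6} = Wo_class [1, 4, 6]"
  "E6_cl {1, 2, 6} = Wo_class [1, 2, 6]"
  "E6_cl {3, 4, 5} = Wo_class [3, 4, 3, 5, 4, 3]"
  by ((rule E6_cl_eqI, rule longest_words_mem, force)+)

text \<open>The conjugator \<open>[4, 2]\<close> moves the simple root 4 to 2,
  \<open>[3, 5, 1, 6]\<close> moves 3 and 5 to 1 and 6, and \<open>[2, 4]\<close> moves 2 to 4; each
  fixes the other simple roots involved.\<close>

lemma Wo_class_relations: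
  "Wo_class [4] = Wo_class [2]"
  "Wo_class [3, 5] = Wo_class [1, 6]"
  "Wo_class [1, 2, 6] = Wo_class [1, 4, 6]"
  "Wo_class [2, 3, 5] = Wo_class [1, 2, 6]"
  by (rule Wo_class_eqI[of "[4, 2]"] Wo_class_eqI[of "[3, 5, 1, 6]"] Wo_class_eqI[of "[2, 4]"]; simp add: compute6)+

text \<open>Each conjugator is a product of \<open>s_2\<close>, \<open>s_4\<close>,
  \<open>s_3 s_5\<close> and \<open>s_1 s_6\<close>, hence lies in W_o. As the longest element is
  central there with square one, the way back uses the inverse conjugator, up to commuting
  letters.\<close>

lemma wo_times_words:
  "Wo_class (wo_word @ []) = Wo_class wo_word"
  "Wo_class (wo_word @ wo_word) = Wo_class []"
  "Wo_class (wo_word @ [2]) = Wo_class A5_word"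
  "Wo_class (wo_word @ A5_word) = Wo_class [2]"
  "Wo_class (wo_word @ [1, 6]) = Wo_class D4_word"
  "Wo_class (wo_word @ D4_word) = Wo_class [1, 6]"
  "Wo_class (wo_word @ [1, 4, 6]) = Wo_class [1, 4, 6]"
  "Wo_class (wo_word @ [3, 4, 3, 5, 4, 3]) = Wo_class [3, 4, 3, 5, 4, 3]"
proof -
  note [simp] = compute6 A5_word_def D4_word_def
  show "Wo_class (wo_word @ []) = Wo_class wo_word"
    by (rule Wo_class_eqI[of "[]"]) simp_all
  show "Wo_class (wo_word @ wo_word) = Wo_class []"
    by (rule Wo_class_eqI[of "[]"]) simp_all
  show "Wo_class (wo_word @ [2]) = Wo_class A5_word"
    by (rule Wo_class_eqI[of "[2, 4, 3, 5, 4, 1, 6, 3, 5, 4]"]) simp_all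
  \<comment> \<open>For \<open>I = {1, 3, 4, 5, 6}\<close>, \<open>w_o w_I\<close> is the reflection
    in the highest root: \<open>w_I\<close> agrees with \<open>w_o\<close> on the span of
    \<open>I\<close> and fixes that root, which \<open>w_o\<close> negates.\<close>
  show "Wo_class (wo_word @ A5_word) = Wo_class [2]"
    by (rule Wo_class_eqI[of "[4, 3, 5, 4, 1, 6, 3, 5, 4, 2]"]) simp_all
  show "Wo_class (wo_word @ [1, 6]) = Wo_class D4_word"
    by (rule Wo_class_eqI[of "[1, 6, 3, 5, 4, 2, 3, 5, 4, 3, 5]"]) simp_all
  show "Wo_class (wo_word @ D4_word) = Wo_class [1, 6]"
    by (rule Wo_class_eqI[of "[3, 5, 4, 2, 3, 5, 4, 3, 5, 1, 6]"]) simp_all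
  show "Wo_class (wo_word @ [1, 4, 6]) = Wo_class [1, 4, 6]"
    by (rule Wo_class_eqI[of "[2, 3, 5, 4, 2, 3, 5, 1, 6, 3, 5, 4, 2, 3, 5]"]) simp_all
  show "Wo_class (wo_word @ [3, 4, 3, 5, 4, 3]) = Wo_class [3, 4, 3, 5, 4, 3]"
    by (rule Wo_class_eqI[of "[2, 4, 1, 6, 3, 5, 4, 2, 3, 5, 1, 6]"]) simp_all
qed

theorem mainTheorem6:
  shows
    "(\<forall>I \<in> {{}, {1, 2, 3, 4, 5, 6}, {2}, {4}, {1, 3, 4, 5, 6}, {1, 6}, {3, 5}, {2, 3, 4, 5},
             {1, 4, 6}, {1, 2, 6}, {3, 4, 5}}. E6_long I \<in> carrier E6_Wo) \<and>
     E6_cl {2} = E6_cl {4} \<and>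
     E6_cl {1, 6} = E6_cl {3, 5} \<and>
     E6_cl {1, 4, 6} = E6_cl {1, 2, 6} \<and>
     distinct [E6_cl {}, E6_cl {1, 2, 3, 4, 5, 6}, E6_cl {2}, E6_cl {1, 3, 4, 5, 6},
               E6_cl {1, 6}, E6_cl {2, 3, 4, 5}, E6_cl {1, 4, 6}, E6_cl {3, 4, 5}] \<and>
     conj_class E6_Wo ` involutions E6_Wo =
       {E6_cl {}, E6_cl {1, 2, 3, 4, 5, 6}, E6_cl {2}, E6_cl {1, 3, 4, 5, 6},
        E6_cl {1, 6}, E6_cl {2, 3, 4, 5}, E6_cl {1, 4, 6}, E6_cl {3, 4, 5}} \<and>
     E6_wo_times (E6_cl {}) = E6_cl {1, 2, 3, 4, 5, 6} \<and>
     E6_wo_times (E6_cl {1, 2, 3, 4, 5, 6}) = E6_cl {} \<and>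
     E6_wo_times (E6_cl {2}) = E6_cl {1, 3, 4, 5, 6} \<and>
     E6_wo_times (E6_cl {1, 3, 4, 5, 6}) = E6_cl {2} \<and>
     E6_wo_times (E6_cl {1, 6}) = E6_cl {2, 3, 4, 5} \<and>
     E6_wo_times (E6_cl {2, 3, 4, 5}) = E6_cl {1, 6} \<and>
     E6_wo_times (E6_cl {1, 4, 6}) = E6_cl {1, 4, 6} \<and>
     E6_wo_times (E6_cl {3, 4, 5}) = E6_cl {3, 4, 5}"
proof -
  let ?us = "[[], wo_word, [2], A5_word, [1, 6], D4_word, [1, 4, 6], [3, 4, 3, 5, 4, 3]]"
  have W: "Wo_word u" if "u \<in> set ?us" for u
    using that longest_words_mem[THEN longest_words_Wo] by auto
  \<comment> \<open>The trace alone does not suffice: it is -2 for \<open>wo_word\<close> and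
    \<open>D4_word\<close>, 0 for \<open>A5_word\<close> and \<open>[1, 4, 6]\<close>, and 2 for
    \<open>[1, 6]\<close> and \<open>[3, 4, 3, 5, 4, 3]\<close>.\<close>
  have "distinct (map (\<lambda>u. (trace6 u, trace6 (wo_word @ u))) ?us)"
    by (simp add: compute6 trace6_def A5_word_def D4_word_def)
  from Wo_class_trace_inj[OF W this] have distinct: "distinct (map Wo_class ?us)" .
  have long: "\<forall>I \<in> {{}, {1, 2, 3, 4, 5, 6}, {2}, {4}, {1, 3, 4, 5, 6}, {1, 6}, {3, 5}, {2, 3, 4, 5},
      {1, 4, 6}, {1, 2, 6}, {3, 4, 5}}. E6_long I \<in> carrier E6_Wo"
    unfolding ball_simps
    by (intro conjI TrueI) ((rule E6_long_Wo, rule longest_words_mem, force)+)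
  \<comment> \<open>The relations absorb \<open>[4]\<close>, \<open>[3, 5]\<close>,
    \<open>[1, 2, 6]\<close> and \<open>[2, 3, 5]\<close>, which leaves eight of the twelve
    words.\<close>
  have inv: "Wo_class ` set central_words = set (map Wo_class ?us)"
    unfolding central_words_eq
    by (simp add: longest_words_def A5_word_def[symmetric, simplified] D4_word_def[symmetric]
        Wo_class_relations[simplified] insert_commute)
  have times: "E6_wo_times (Wo_class u) = Wo_class (wo_word @ u)" if "u \<in> set ?us" for u
    using wo_times_Wo_class W[OF that] by blast
  show ?thesis
    unfolding E6_cl_words conj_classes_involutions inv Wo_class_relations
    using long distinct times by (simp add: wo_times_words[simplified])
qed

end
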